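(* Let $X$ be a geodesic metric space and let $\mathcal{P}$ be a collection of subsets of $X$. Then $X$ is hyperbolic relative to $\mathcal{P}$ if and only if $\mathcal{P}$ satisfies $(\alpha_1)$ and $(\alpha_2)$ and $X$ is weakly $( * )$-asymptotically tree-graded with respect to $\mathcal{P}$.
   Context: $N_K(A)=\{x\in X:d(x,A)\le K\}$. An almost-geodesic is a continuous quasi-geodesic. $(\alpha_1)$: for each $K$ there is $B$ with $diam(N_K(P)\cap N_K(Q))\le B$ for all distinct $P,Q\in\mathcal{P}$. $(\alpha_2)$: there are $\epsilon\in(0,1/2)$, $M\ge0$ such that for each $P\in\mathcal{P}$ and $x,y\in X$ with $x,y\in N_{\epsilon d(x,y)}(P)$, any geodesic from $x$ to $y$ intersects $N_M(P)$. $X$ is $( * )$-asymptotically tree-graded (resp. weakly $( * )$-asymptotically tree-graded) with respect to $\mathcal{P}$ if for every $C\ge0$ there are $\sigma,\delta$ such that every triangle with $(1,C)$-almost-geodesic sides (resp. every geodesic triangle) $\gamma_1,\gamma_2,\gamma_3$ satisfies either (C) there is a ball of radius $\sigma$ intersecting all sides of the triangle, or (P) there is $P\in\mathcal{P}$ such that $N_\sigma(P)$ intersects all sides of the triangle and the entrance points $x_i$ (resp. exit points $y_i$) of the sides $\gamma_i$ in (from) $N_\sigma(P)$ satisfy $d(y_i,x_{i+1})\le\delta$ (indices mod 3, sides oriented cyclically). $X$ is hyperbolic relative to $\mathcal{P}$ if $\mathcal{P}$ satisfies $(\alpha_1)$ and $(\alpha_2)$ and $X$ is $( * )$-asymptotically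 tree-graded with respect to $\mathcal{P}$. *)

theory Defs
  imports "HOL-Analysis.Analysis"
begin

text \<open>
  The space \<open>X\<close> is the whole type \<open>'a\<close>. A path is a map \<open>\<gamma> :: real \<Rightarrow> 'a\<close> together with a
  length \<open>L \<ge> 0\<close>; only the values of \<open>\<gamma>\<close> on \<open>{0..L}\<close> matter.
\<close>

(* The guard P \<noteq> {} encodes d(x, {}) = \<infinity>; the library has infdist x {} = 0. *)
definition nbhd :: "real \<Rightarrow> 'a::metric_space set \<Rightarrow> 'a set" where
  "nbhd K P = {x. P \<noteq> {} \<and> infdist x P \<le> K}"

definition geodesic :: "(real \<Rightarrow> 'a::metric_space) \<Rightarrow> real \<Rightarrow> bool" where
  "geodesic \<gamma> L \<longleftrightarrow> 0 \<le> L \<and> (\<forall>s\<in>{0..L}. \<forall>t\<in>{0..L}. dist (\<gamma> s) (\<gamma> t) = \<bar>s - t\<bar>)"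

definition geodesic_space :: "'a::metric_space itself \<Rightarrow> bool" where
  "geodesic_space TYPE('a) \<longleftrightarrow>
     (\<forall>x y :: 'a. \<exists>\<gamma> L. geodesic \<gamma> L \<and> \<gamma> 0 = x \<and> \<gamma> L = y)"

definition quasi_geodesic ::
    "real \<Rightarrow> real \<Rightarrow> (real \<Rightarrow> 'a::metric_space) \<Rightarrow> real \<Rightarrow> bool" where
  "quasi_geodesic k c \<gamma> L \<longleftrightarrow> 0 \<le> L \<and>
     (\<forall>s\<in>{0..L}. \<forall>t\<in>{0..L}.
        \<bar>s - t\<bar> / k - c \<le> dist (\<gamma> s) (\<gamma> t) \<and> dist (\<gamma> s) (\<gamma> t) \<le> k * \<bar>s - t\<bar> + c)"

definition almost_geodesic ::
    "real \<Rightarrow> real \<Rightarrow> (real \<Rightarrow> 'a::metric_space) \<Rightarrow> real \<Rightarrow> bool" where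
  "almost_geodesic k c \<gamma> L \<longleftrightarrow> quasi_geodesic k c \<gamma> L \<and> continuous_on {0..L} \<gamma>"

(* "bounded" is needed because the library diameter is unspecified on unbounded sets. *)
definition alpha1 :: "'a::metric_space set set \<Rightarrow> bool" where
  "alpha1 \<P> \<longleftrightarrow>
     (\<forall>K. \<exists>B. \<forall>P\<in>\<P>. \<forall>Q\<in>\<P>. P \<noteq> Q \<longrightarrow>
        bounded (nbhd K P \<inter> nbhd K Q) \<and> diameter (nbhd K P \<inter> nbhd K Q) \<le> B)"

definition alpha2 :: "'a::metric_space set set \<Rightarrow> bool" where
  "alpha2 \<P> \<longleftrightarrow>
     (\<exists>\<epsilon> M. 0 < \<epsilon> \<and> \<epsilon> < 1/2 \<and> 0 \<le> M \<and>
        (\<forall>P\<in>\<P>. \<forall>x y. x \<in> nbhd (\<epsilon> * dist x y) P \<and> y \<in> nbhd (\<epsilon> * dist x y) P \<longrightarrow>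
           (\<forall>\<gamma> L. geodesic \<gamma> L \<and> \<gamma> 0 = x \<and> \<gamma> L = y \<longrightarrow>
              \<gamma> ` {0..L} \<inter> nbhd M P \<noteq> {})))"

text \<open>
  Entrance and exit points are the first and last points of the path in \<open>S\<close>. They exist whenever
  a continuous path meets \<open>S = nbhd K P\<close>, since this set is closed.
\<close>

definition is_entrance_point ::
    "(real \<Rightarrow> 'a::metric_space) \<Rightarrow> real \<Rightarrow> 'a set \<Rightarrow> 'a \<Rightarrow> bool" where
  "is_entrance_point \<gamma> L S x \<longleftrightarrow>
     (\<exists>t\<in>{0..L}. \<gamma> t = x \<and> x \<in> S \<and> (\<forall>s\<in>{0..L}. \<gamma> s \<in> S \<longrightarrow> t \<le> s))"

definition is_exit_point ::
    "(real \<Rightarrow> 'a::metric_space) \<Rightarrow> real \<Rightarrow> 'a set \<Rightarrow> 'a \<Rightarrow> bool" where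
  "is_exit_point \<gamma> L S y \<longleftrightarrow>
     (\<exists>t\<in>{0..L}. \<gamma> t = y \<and> y \<in> S \<and> (\<forall>s\<in>{0..L}. \<gamma> s \<in> S \<longrightarrow> s \<le> t))"

text \<open>
  The sides of a triangle are \<open>\<gamma> 0\<close>, \<open>\<gamma> 1\<close>, \<open>\<gamma> 2\<close>, of lengths \<open>L 0\<close>, \<open>L 1\<close>, \<open>L 2\<close>, each starting
  where the previous one ends (indices mod 3).
\<close>

definition triangle :: "(nat \<Rightarrow> real \<Rightarrow> 'a::metric_space) \<Rightarrow> (nat \<Rightarrow> real) \<Rightarrow> bool" where
  "triangle \<gamma> L \<longleftrightarrow> (\<forall>i<3. 0 \<le> L i \<and> \<gamma> i (L i) = \<gamma> (Suc i mod 3) 0)"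

definition cond_C ::
    "real \<Rightarrow> (nat \<Rightarrow> real \<Rightarrow> 'a::metric_space) \<Rightarrow> (nat \<Rightarrow> real) \<Rightarrow> bool" where
  "cond_C \<sigma> \<gamma> L \<longleftrightarrow> (\<exists>a. \<forall>i<3. \<gamma> i ` {0..L i} \<inter> cball a \<sigma> \<noteq> {})"

definition cond_P ::
    "'a::metric_space set set \<Rightarrow> real \<Rightarrow> real \<Rightarrow>
      (nat \<Rightarrow> real \<Rightarrow> 'a) \<Rightarrow> (nat \<Rightarrow> real) \<Rightarrow> bool" where
  "cond_P \<P> \<sigma> \<delta> \<gamma> L \<longleftrightarrow>
     (\<exists>P\<in>\<P>. (\<forall>i<3. \<gamma> i ` {0..L i} \<inter> nbhd \<sigma> P \<noteq> {}) \<and>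
        (\<exists>x y. (\<forall>i<3. is_entrance_point (\<gamma> i) (L i) (nbhd \<sigma> P) (x i) \<and>
                      is_exit_point (\<gamma> i) (L i) (nbhd \<sigma> P) (y i)) \<and>
               (\<forall>i<3. dist (y i) (x (Suc i mod 3)) \<le> \<delta>)))"

(* The argument "side C" is the class of paths allowed as sides for the constant C. *)
definition triangle_condition ::
    "(real \<Rightarrow> (real \<Rightarrow> 'a::metric_space) \<Rightarrow> real \<Rightarrow> bool) \<Rightarrow> 'a set set \<Rightarrow> bool" where
  "triangle_condition side \<P> \<longleftrightarrow>
     (\<forall>C\<ge>0. \<exists>\<sigma> \<delta>. \<forall>\<gamma> L. triangle \<gamma> L \<and> (\<forall>i<3. side C (\<gamma> i) (L i)) \<longrightarrow>
        cond_C \<sigma> \<gamma> L \<or> cond_P \<P> \<sigma> \<delta> \<gamma> L)"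

definition star_asymp_tree_graded :: "'a::metric_space set set \<Rightarrow> bool" where
  "star_asymp_tree_graded \<P> \<longleftrightarrow> triangle_condition (\<lambda>C. almost_geodesic 1 C) \<P>"

definition weakly_star_asymp_tree_graded :: "'a::metric_space set set \<Rightarrow> bool" where
  "weakly_star_asymp_tree_graded \<P> \<longleftrightarrow> triangle_condition (\<lambda>C. geodesic) \<P>"

definition hyperbolic_relative_to :: "'a::metric_space set set \<Rightarrow> bool" where
  "hyperbolic_relative_to \<P> \<longleftrightarrow> alpha1 \<P> \<and> alpha2 \<P> \<and> star_asymp_tree_graded \<P>"

end

theory Submission imports Defs begin

text \<open>
  One direction is immediate, since a geodesic is a \<open>(1,C)\<close>-almost-geodesic for every \<open>C \<ge> 0\<close>. For
  the other one, the geodesic triangle condition is first turned into a theory of coarse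
  projections to the members of \<open>\<P>\<close>, and then every almost-geodesic is compared with geodesics by
  looking at triangles with one vertex on it.

  By \<open>(\<alpha>\<^sub>2)\<close> the members of \<open>\<P>\<close> are quasi-convex (\<open>segment_in_hull\<close>). If \<open>p\<close> is an almost closest
  point of \<open>P\<close> to \<open>x\<close>, then the triangle condition, with \<open>(\<alpha>\<^sub>1)\<close> to control the other members of \<open>\<P>\<close>,
  shows that every geodesic from \<open>x\<close> to a point near \<open>P\<close> passes near \<open>p\<close>
  (\<open>segment_meets_projection\<close>). If the projections of \<open>x\<close> and \<open>y\<close> to \<open>P\<close> are far apart, then every
  geodesic from \<open>x\<close> to \<open>y\<close> meets a neighbourhood of \<open>P\<close> (\<open>segment_meets_nbhd\<close>), and hence passes near
  both projections.

  A point \<open>x\<close> of a \<open>(1,c)\<close>-almost-geodesic from \<open>a\<close> to \<open>b\<close> satisfies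
  \<open>d(a,x) + d(x,b) \<le> d(a,b) + 3c\<close>. For a geodesic from \<open>a\<close> to \<open>b\<close> and its point \<open>z\<close> with
  \<open>d(a,z) = d(a,x)\<close>, the triangle \<open>a, x, b\<close> shows that either \<open>x\<close> is near \<open>z\<close>, or both lie near some
  \<open>Q \<in> \<P>\<close> along which the geodesic travels on both sides of \<open>z\<close> (\<open>drift_dichotomy\<close>). So an
  almost-geodesic may leave the geodesic, as it can in a Euclidean plane, but only near members
  of \<open>\<P>\<close>. Continuity provides an \<open>x\<close> on the almost-geodesic for each \<open>z\<close>. It follows that the
  almost-geodesic meets a neighbourhood of every \<open>Q\<close> to which \<open>a\<close> and \<open>b\<close> project far apart
  (\<open>far_projections_meet\<close>), and that its entrance point in a large neighbourhood of \<open>Q\<close> is near the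
  projection of \<open>a\<close> (\<open>entrance_near_projection\<close>).

  Now take a triangle with almost-geodesic sides. If the three vertices have pairwise far
  projections to some \<open>Q \<in> \<P>\<close>, then case (P) holds for \<open>Q\<close>, with entrance and exit points near the
  projections of the vertices. Otherwise a geodesic triangle on the same vertices has a point \<open>a\<close>
  near all its sides, even if it is itself in case (P), because two of the projections are then
  close together (\<open>common_point\<close>). The corresponding points of the almost-geodesic sides are near
  \<open>a\<close> as well: if one of them were far from its geodesic side, then the vertices would have
  pairwise far projections to the \<open>Q\<close> given by the dichotomy (\<open>wander_spread\<close>). So case (C) holds.
\<close>

section \<open>Neighbourhoods, coarse projections and geodesic segments\<close>

lemma nbhd_mono: "x \<in> nbhd K P \<Longrightarrow> K \<le> K' \<Longrightarrow> x \<in> nbhd K' P"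
  by (auto simp: nbhd_def)

lemma nbhd_step: "x \<in> nbhd K P \<Longrightarrow> dist x y \<le> r \<Longrightarrow> K + r \<le> K' \<Longrightarrow> y \<in> nbhd K' P"
  using infdist_triangle[of y P x] by (auto simp: nbhd_def dist_commute)

lemma mem_nbhd: "p \<in> P \<Longrightarrow> 0 \<le> K \<Longrightarrow> p \<in> nbhd K P"
  by (auto simp: nbhd_def)

lemma infdist_approx:
  assumes "P \<noteq> {}"
  shows "\<exists>p\<in>P. dist x p < infdist x P + 1"
proof (rule ccontr)
  assume "\<not> ?thesis"
  then have "infdist x P + 1 \<le> (INF p\<in>P. dist x p)"
    using assms by (intro cINF_greatest) (auto simp: not_less)
  then have "infdist x P + 1 \<le> infdist x P" using assms by (simp add: infdist_notempty)
  then show False by simp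
qed

definition coarse_projection :: "'a::metric_space set \<Rightarrow> 'a \<Rightarrow> 'a \<Rightarrow> bool" where
  "coarse_projection P x p \<longleftrightarrow> p \<in> P \<and> (\<forall>q\<in>P. dist x p \<le> dist x q + 1)"

lemma coarse_projection_ex:
  assumes "P \<noteq> {}"
  shows "\<exists>p. coarse_projection P x p"
proof -
  obtain p where p: "p \<in> P" "dist x p < infdist x P + 1"
    using infdist_approx[OF assms] by blast
  have "dist x p \<le> dist x q + 1" if "q \<in> P" for q
    using p infdist_le[OF that, of x] by linarith
  with p show ?thesis by (auto simp: coarse_projection_def)
qed

text \<open>
  Geodesics are handled through their images: a point of a segment is determined by its distance
  to one end, reversing the direction keeps the set, and a subsegment is a subset.
\<close>
definition geodesic_segment :: "'a::metric_space set \<Rightarrow> 'a \<Rightarrow> 'a \<Rightarrow> bool" where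
  "geodesic_segment S x y \<longleftrightarrow> (\<exists>\<gamma> L. geodesic \<gamma> L \<and> \<gamma> 0 = x \<and> \<gamma> L = y \<and> S = \<gamma> ` {0..L})"

lemma segmentE:
  assumes "geodesic_segment S x y"
  obtains \<gamma> where "geodesic \<gamma> (dist x y)" "\<gamma> 0 = x" "\<gamma> (dist x y) = y" "S = \<gamma> ` {0..dist x y}"
    "\<And>t. 0 \<le> t \<Longrightarrow> t \<le> dist x y \<Longrightarrow> dist x (\<gamma> t) = t"
proof -
  obtain \<gamma> L where g: "geodesic \<gamma> L" "\<gamma> 0 = x" "\<gamma> L = y" "S = \<gamma> ` {0..L}"
    using assms by (auto simp: geodesic_segment_def)
  then have L: "0 \<le> L" by (simp add: geodesic_def)
  have d: "dist x (\<gamma> t) = t" if "0 \<le> t" "t \<le> L" for t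
    using g(1) that L unfolding geodesic_def g(2)[symmetric] by auto
  have "dist x y = L" using d[of L] L g(3) by auto
  with g d show ?thesis by (intro that[of \<gamma>]) auto
qed

lemma segment_dist:
  assumes "geodesic_segment S x y" "v \<in> S" "w \<in> S"
  shows "dist v w = \<bar>dist x v - dist x w\<bar>"
  by (rule segmentE[OF assms(1)]) (use assms(2,3) in \<open>auto simp: geodesic_def\<close>)

lemma segment_end:
  assumes "geodesic_segment S x y"
  shows "x \<in> S" "y \<in> S"
proof -
  obtain \<gamma> where g: "\<gamma> 0 = x" "\<gamma> (dist x y) = y" "S = \<gamma> ` {0..dist x y}"
    by (rule segmentE[OF assms])
  have "\<gamma> 0 \<in> S" "\<gamma> (dist x y) \<in> S" unfolding g(3) by (intro imageI; simp)+
  then show "x \<in> S" "y \<in> S" using g by simp_all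
qed

lemma segment_dist_add:
  assumes "geodesic_segment S x y" "v \<in> S"
  shows "dist x v + dist v y = dist x y"
proof -
  have "dist x v \<le> dist x y"
    by (rule segmentE[OF assms(1)]) (use assms(2) in auto)
  then show ?thesis
    using segment_dist[OF assms segment_end(2)[OF assms(1)]] by auto
qed

lemma segment_point:
  assumes "geodesic_segment S x y" "0 \<le> s" "s \<le> dist x y"
  shows "\<exists>v\<in>S. dist x v = s"
  by (rule segmentE[OF assms(1)]) (use assms(2,3) in auto)

lemma segment_rev:
  assumes "geodesic_segment S x y"
  shows "geodesic_segment S y x"
proof -
  obtain \<gamma> where g: "geodesic \<gamma> (dist x y)" "\<gamma> 0 = x" "\<gamma> (dist x y) = y" "S = \<gamma> ` {0..dist x y}"
    by (rule segmentE[OF assms])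
  have "geodesic (\<lambda>t. \<gamma> (dist x y - t)) (dist x y)"
    using g(1) by (auto simp: geodesic_def)
  moreover have "S = (\<lambda>t. \<gamma> (dist x y - t)) ` {0..dist x y}"
  proof -
    have "(\<lambda>t. dist x y - t) ` {0..dist x y} = {0..dist x y}"
      by (auto simp: image_iff intro!: bexI[of _ "dist x y - _"])
    then show ?thesis unfolding g(4) by (metis image_image)
  qed
  ultimately show ?thesis
    unfolding geodesic_segment_def using g(2,3)
    by (intro exI[of _ "\<lambda>t. \<gamma> (dist x y - t)"] exI[of _ "dist x y"]) auto
qed

lemma segment_sub:
  assumes S: "geodesic_segment S x y" and vw: "v \<in> S" "w \<in> S" "dist x v \<le> dist x w"
  shows "geodesic_segment {u \<in> S. dist x v \<le> dist x u \<and> dist x u \<le> dist x w} v w"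
proof -
  obtain \<gamma> where g: "geodesic \<gamma> (dist x y)" "S = \<gamma> ` {0..dist x y}"
    and d: "\<And>t. 0 \<le> t \<Longrightarrow> t \<le> dist x y \<Longrightarrow> dist x (\<gamma> t) = t"
    by (rule segmentE[OF S]) (rule that)
  define a b where "a = dist x v" and "b = dist x w"
  have ab: "0 \<le> a" "a \<le> b" "b \<le> dist x y" "\<gamma> a = v" "\<gamma> b = w"
    using vw g(2) d by (auto simp: a_def b_def)
  have "geodesic (\<lambda>t. \<gamma> (a + t)) (b - a)"
    using g(1) ab by (auto simp: geodesic_def)
  moreover have "{u \<in> S. a \<le> dist x u \<and> dist x u \<le> b} = (\<lambda>t. \<gamma> (a + t)) ` {0..b - a}"
  proof (intro equalityI subsetI)
    fix u assume "u \<in> {u \<in> S. a \<le> dist x u \<and> dist x u \<le> b}"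
    then obtain t where "u = \<gamma> t" "a \<le> t" "t \<le> b" using d g(2) by auto
    then show "u \<in> (\<lambda>t. \<gamma> (a + t)) ` {0..b - a}"
      by (intro image_eqI[of _ _ "t - a"]) auto
  next
    fix u assume "u \<in> (\<lambda>t. \<gamma> (a + t)) ` {0..b - a}"
    then show "u \<in> {u \<in> S. a \<le> dist x u \<and> dist x u \<le> b}" using d g(2) ab by auto
  qed
  ultimately show ?thesis
    unfolding geodesic_segment_def a_def[symmetric] b_def[symmetric] using ab
    by (intro exI[of _ "\<lambda>t. \<gamma> (a + t)"] exI[of _ "b - a"]) auto
qed

lemma segment_init:
  assumes "geodesic_segment S x y" "w \<in> S"
  shows "geodesic_segment {u \<in> S. dist x u \<le> dist x w} x w"
  using segment_sub[OF assms(1) segment_end(1)[OF assms(1)] assms(2)] by simp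

lemma segment_compact:
  assumes "geodesic_segment S x y"
  shows "compact S"
proof -
  obtain \<gamma> where g: "geodesic \<gamma> (dist x y)" "S = \<gamma> ` {0..dist x y}"
    by (rule segmentE[OF assms]) (rule that)
  have "1-lipschitz_on {0..dist x y} \<gamma>"
    using g(1) by (intro lipschitz_onI) (auto simp: geodesic_def dist_real_def)
  then show ?thesis
    unfolding g(2) by (intro compact_continuous_image lipschitz_on_continuous_on compact_Icc)
qed

text \<open>
  A geodesic to an almost closest point of \<open>P\<close> comes near \<open>P\<close> only at its end, because a detour
  through a point of \<open>P\<close> near \<open>w\<close> would be too short.
\<close>
lemma coarse_projection_near:
  assumes "coarse_projection P x p" "geodesic_segment S x p" "w \<in> S" "w \<in> nbhd K P"
  shows "dist w p \<le> K + 2"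
proof -
  have "P \<noteq> {}" "infdist w P \<le> K" using assms(4) by (auto simp: nbhd_def)
  then obtain q where q: "q \<in> P" "dist w q \<le> K + 1"
    using infdist_approx[of P w] by force
  have "dist x p \<le> dist x q + 1" using assms(1) q by (auto simp: coarse_projection_def)
  then show ?thesis
    using q segment_dist_add[OF assms(2,3)] dist_triangle[of x q w] by linarith
qed

section \<open>Almost straight paths\<close>

text \<open>
  What is kept of an almost-geodesic, besides its continuity, is that its triangle inequalities are
  almost equalities. This is expressed by distances between its points, and is invariant under
  reversal.
\<close>
definition almost_straight :: "real \<Rightarrow> (real \<Rightarrow> 'a::metric_space) \<Rightarrow> real \<Rightarrow> bool" where
  "almost_straight C \<alpha> L \<longleftrightarrow> 0 \<le> L \<and> continuous_on {0..L} \<alpha> \<and>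
     (\<forall>s t u. 0 \<le> s \<and> s \<le> t \<and> t \<le> u \<and> u \<le> L \<longrightarrow>
        dist (\<alpha> s) (\<alpha> t) + dist (\<alpha> t) (\<alpha> u) \<le> dist (\<alpha> s) (\<alpha> u) + C)"

lemma almost_geodesic_almost_straight:
  assumes "almost_geodesic 1 c \<alpha> L"
  shows "almost_straight (3 * c) \<alpha> L"
proof -
  have L: "0 \<le> L" and q: "\<bar>s - t\<bar> - c \<le> dist (\<alpha> s) (\<alpha> t)" "dist (\<alpha> s) (\<alpha> t) \<le> \<bar>s - t\<bar> + c"
    if "0 \<le> s" "s \<le> L" "0 \<le> t" "t \<le> L" for s t
    using assms that unfolding almost_geodesic_def quasi_geodesic_def by auto
  have "dist (\<alpha> s) (\<alpha> t) + dist (\<alpha> t) (\<alpha> u) \<le> dist (\<alpha> s) (\<alpha> u) + 3 * c"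
    if "0 \<le> s" "s \<le> t" "t \<le> u" "u \<le> L" for s t u
    using q(2)[of s t] q(2)[of t u] q(1)[of s u] that by linarith
  then show ?thesis
    using assms unfolding almost_straight_def almost_geodesic_def quasi_geodesic_def by blast
qed

lemma almost_straight_rev:
  assumes "almost_straight C \<alpha> L"
  shows "almost_straight C (\<lambda>t. \<alpha> (L - t)) L"
proof -
  have "continuous_on {0..L} (\<lambda>t. \<alpha> (L - t))"
    using assms unfolding almost_straight_def
    by (intro continuous_on_compose2[of "{0..L}" \<alpha> "{0..L}" "\<lambda>t. L - t"])
      (auto intro: continuous_on_diff continuous_on_const continuous_on_id)
  moreover have "dist (\<alpha> (L - s)) (\<alpha> (L - t)) + dist (\<alpha> (L - t)) (\<alpha> (L - u))
      \<le> dist (\<alpha> (L - s)) (\<alpha> (L - u)) + C"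
    if "0 \<le> s" "s \<le> t" "t \<le> u" "u \<le> L" for s t u
  proof -
    have "dist (\<alpha> (L - u)) (\<alpha> (L - t)) + dist (\<alpha> (L - t)) (\<alpha> (L - s))
      \<le> dist (\<alpha> (L - u)) (\<alpha> (L - s)) + C"
      using assms that unfolding almost_straight_def by auto
    then show ?thesis by (simp add: dist_commute add.commute)
  qed
  ultimately show ?thesis using assms unfolding almost_straight_def by blast
qed

lemma almost_straight_point:
  assumes "almost_straight C \<alpha> L" "0 \<le> s" "s \<le> u" "u \<le> L" "0 \<le> r" "r \<le> dist (\<alpha> s) (\<alpha> u)"
  shows "\<exists>t\<in>{s..u}. dist (\<alpha> s) (\<alpha> t) = r \<and>
    dist (\<alpha> s) (\<alpha> t) + dist (\<alpha> t) (\<alpha> u) \<le> dist (\<alpha> s) (\<alpha> u) + C"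
proof -
  have "continuous_on {s..u} \<alpha>"
    by (rule continuous_on_subset[of "{0..L}"]) (use assms in \<open>auto simp: almost_straight_def\<close>)
  then have "continuous_on {s..u} (\<lambda>t. dist (\<alpha> s) (\<alpha> t))" by (intro continuous_intros)
  then obtain t where "s \<le> t" "t \<le> u" "dist (\<alpha> s) (\<alpha> t) = r"
    using IVT'[of "\<lambda>t. dist (\<alpha> s) (\<alpha> t)" s r u] assms by auto
  moreover from this have "dist (\<alpha> s) (\<alpha> t) + dist (\<alpha> t) (\<alpha> u) \<le> dist (\<alpha> s) (\<alpha> u) + C"
    using assms(1-4) unfolding almost_straight_def by blast
  ultimately show ?thesis by auto
qed

lemma entrance_point_mem: "is_entrance_point \<gamma> L S x \<Longrightarrow> x \<in> \<gamma> ` {0..L} \<and> x \<in> S"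
  and exit_point_mem: "is_exit_point \<gamma> L S x \<Longrightarrow> x \<in> \<gamma> ` {0..L} \<and> x \<in> S"
  unfolding is_entrance_point_def is_exit_point_def by blast+

lemma exit_point_rev:
  assumes "is_entrance_point (\<lambda>t. \<alpha> (L - t)) L S y"
  shows "is_exit_point \<alpha> L S y"
proof -
  obtain t where t: "t \<in> {0..L}" "\<alpha> (L - t) = y" "y \<in> S"
    and min: "\<And>s. s \<in> {0..L} \<Longrightarrow> \<alpha> (L - s) \<in> S \<Longrightarrow> t \<le> s"
    using assms unfolding is_entrance_point_def by blast
  have "s \<le> L - t" if "s \<in> {0..L}" "\<alpha> s \<in> S" for s
    using min[of "L - s"] that by auto
  with t show ?thesis unfolding is_exit_point_def by (intro bexI[of _ "L - t"]) auto
qed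

lemma closed_nbhd: "closed (nbhd K P)"
proof (cases "P = {}")
  case False
  then have "nbhd K P = {x. infdist x P \<le> K}" by (auto simp: nbhd_def)
  then show ?thesis by (simp add: closed_Collect_le continuous_intros)
qed (simp add: nbhd_def)

lemma entrance_point_ex:
  assumes "almost_straight C \<alpha> L" "t \<in> {0..L}" "\<alpha> t \<in> nbhd K P"
  shows "\<exists>e. is_entrance_point \<alpha> L (nbhd K P) e"
proof -
  let ?T = "{0..L} \<inter> \<alpha> -` nbhd K P"
  have "compact ({0..L} \<inter> ?T)"
    using assms(1) unfolding almost_straight_def
    by (intro compact_Int_closed compact_Icc continuous_closed_preimage closed_nbhd) auto
  then have "compact ?T" by (simp add: Int_assoc[symmetric])
  then obtain s where "s \<in> ?T" "\<And>u. u \<in> ?T \<Longrightarrow> s \<le> u"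
    using compact_attains_inf[of ?T] assms(2,3) by blast
  then show ?thesis
    unfolding is_entrance_point_def by (intro exI[of _ "\<alpha> s"] bexI[of _ s]) auto
qed

section \<open>Quasi-convexity and projections\<close>

text \<open>
  The hypotheses on \<open>\<P>\<close> in terms of segments. The fact \<open>thin\<close> treats both cases of the triangle
  condition alike: in either of them the sides carry points \<open>e\<^sub>i\<close>, \<open>f\<^sub>i\<close> with \<open>f\<^sub>i\<close> near \<open>e\<^bsub>i+1\<^esub>\<close>, and in
  case (C) moreover \<open>e\<^sub>i = f\<^sub>i\<close>, while in case (P) all of them lie near one \<open>Q \<in> \<P>\<close>.

  The constants of the estimates are explicit functions of \<open>B\<close>, \<open>\<epsilon>\<close>, \<open>M\<close>, \<open>\<delta>\<close>, each defined just before
  the estimate that determines its value. What matters is only on which data they depend.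
\<close>
locale peripheral_family =
  fixes \<P> :: "'a::metric_space set set" and B :: "real \<Rightarrow> real" and \<epsilon> M \<delta> :: real
  assumes segment_ex: "\<exists>S. geodesic_segment S (x::'a) y"
    and B_nonneg: "0 \<le> B K"
    and overlap: "\<lbrakk>P \<in> \<P>; Q \<in> \<P>; P \<noteq> Q; x \<in> nbhd K P; x \<in> nbhd K Q; y \<in> nbhd K P; y \<in> nbhd K Q\<rbrakk>
      \<Longrightarrow> dist x y \<le> B K"
    and eps_pos: "0 < \<epsilon>" and M_nonneg: "0 \<le> M"
    and penetrate: "\<lbrakk>P \<in> \<P>; geodesic_segment S x y; x \<in> nbhd (\<epsilon> * dist x y) P;
      y \<in> nbhd (\<epsilon> * dist x y) P\<rbrakk> \<Longrightarrow> \<exists>z\<in>S. z \<in> nbhd M P"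
    and delta_nonneg: "0 \<le> \<delta>"
    and thin: "\<lbrakk>geodesic_segment S\<^sub>0 x y; geodesic_segment S\<^sub>1 y z; geodesic_segment S\<^sub>2 z x\<rbrakk> \<Longrightarrow>
      \<exists>e\<^sub>0\<in>S\<^sub>0. \<exists>f\<^sub>0\<in>S\<^sub>0. \<exists>e\<^sub>1\<in>S\<^sub>1. \<exists>f\<^sub>1\<in>S\<^sub>1. \<exists>e\<^sub>2\<in>S\<^sub>2. \<exists>f\<^sub>2\<in>S\<^sub>2.
        dist f\<^sub>0 e\<^sub>1 \<le> \<delta> \<and> dist f\<^sub>1 e\<^sub>2 \<le> \<delta> \<and> dist f\<^sub>2 e\<^sub>0 \<le> \<delta> \<and>
        (e\<^sub>0 = f\<^sub>0 \<and> e\<^sub>1 = f\<^sub>1 \<and> e\<^sub>2 = f\<^sub>2 \<or> (\<exists>Q\<in>\<P>. {e\<^sub>0, f\<^sub>0, e\<^sub>1, f\<^sub>1, e\<^sub>2, f\<^sub>2} \<subseteq> nbhd \<delta> Q))"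
begin

definition qhull :: "real \<Rightarrow> real" where
  "qhull K = (max K M + 1) + (max K M + 1) / \<epsilon>"

lemma qhull_ge: "K + 1 \<le> qhull K" "M + 1 \<le> qhull K" "1 \<le> qhull K"
proof -
  have "0 \<le> (max K M + 1) / \<epsilon>" using M_nonneg eps_pos by simp
  then show "K + 1 \<le> qhull K" "M + 1 \<le> qhull K" "1 \<le> qhull K"
    using M_nonneg unfolding qhull_def by auto
qed

text \<open>
  Quasi-convexity. If \<open>z\<close> is far from \<open>P\<close>, cut out the maximal arc around \<open>z\<close> outside \<open>N\<^sub>k(P)\<close> for a
  \<open>k > M\<close>. Its ends lie in \<open>N\<^sub>k(P)\<close>, so if it were longer than \<open>k / \<epsilon>\<close> it would meet \<open>N\<^sub>M(P)\<close> by
  \<open>(\<alpha>\<^sub>2)\<close>. Hence \<open>z\<close> is within \<open>k / \<epsilon>\<close> of an end.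
\<close>
lemma segment_in_hull:
  assumes P: "P \<in> \<P>" and S: "geodesic_segment S x y"
    and x: "x \<in> nbhd K P" and y: "y \<in> nbhd K P" and z: "z \<in> S"
  shows "z \<in> nbhd (qhull K) P"
proof -
  define k where "k = max K M + 1"
  have k: "K \<le> k" "M + 1 \<le> k" "1 \<le> k" using M_nonneg by (auto simp: k_def)
  have hk: "qhull K = k + k / \<epsilon>" by (simp add: qhull_def k_def)
  have kp: "0 \<le> k / \<epsilon>" using k eps_pos by simp
  have ne: "P \<noteq> {}" using x by (auto simp: nbhd_def)
  have mem: "w \<in> nbhd r P \<longleftrightarrow> infdist w P \<le> r" for w r using ne by (auto simp: nbhd_def)
  show ?thesis
  proof (cases "infdist z P \<le> k")
    case True then show ?thesis using kp hk by (simp add: mem)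
  next
    case False
    have cl: "closed {v. infdist v P \<le> k}"
      by (intro closed_Collect_le continuous_intros)
    have cx: "closed {v. dist x v \<le> dist x z}" "closed {v. dist x z \<le> dist x v}"
      by (intro closed_Collect_le continuous_intros)+
    let ?A = "S \<inter> ({v. infdist v P \<le> k} \<inter> {v. dist x v \<le> dist x z})"
    let ?B = "S \<inter> ({v. infdist v P \<le> k} \<inter> {v. dist x z \<le> dist x v})"
    have cA: "compact ?A" "compact ?B"
      by (intro compact_Int_closed closed_Int segment_compact[OF S] cl cx)+
    have xA: "x \<in> ?A" using segment_end[OF S] x k by (simp add: mem)
    have yB: "y \<in> ?B"
    proof -
      have "dist x z \<le> dist x y" using segment_dist_add[OF S z] zero_le_dist[of z y] by linarith
      then show ?thesis using segment_end[OF S] y k by (simp add: mem)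
    qed
    have co: "continuous_on V (dist x)" for V by (intro continuous_intros)
    obtain a where a: "a \<in> ?A" and a_max: "\<And>v. v \<in> ?A \<Longrightarrow> dist x v \<le> dist x a"
      using continuous_attains_sup[OF cA(1) _ co] xA by blast
    obtain b where b: "b \<in> ?B" and b_min: "\<And>v. v \<in> ?B \<Longrightarrow> dist x b \<le> dist x v"
      using continuous_attains_inf[OF cA(2) _ co] yB by blast
    define T where "T = {u \<in> S. dist x a \<le> dist x u \<and> dist x u \<le> dist x b}"
    have T: "geodesic_segment T a b"
      unfolding T_def using a b by (intro segment_sub[OF S]) auto
    have dab: "dist a z = dist x z - dist x a" "dist z b = dist x b - dist x z"
      "dist a b = dist x b - dist x a"
      using segment_dist[OF S] a b z by auto
    have tri: "infdist z P \<le> infdist w P + dist z w" for w using infdist_triangle .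
    have "dist a b \<le> k / \<epsilon>"
    proof (rule ccontr)
      assume "\<not> ?thesis"
      then have "k \<le> \<epsilon> * dist a b" using eps_pos by (simp add: field_simps)
      then obtain w where w: "w \<in> T" "infdist w P \<le> M"
        using penetrate[OF P T] a b by (auto simp: mem)
      have far: "1 < dist w z" using tri[of w] w(2) False k by (simp add: dist_commute)
      have wS: "w \<in> S" "dist x a \<le> dist x w" "dist x w \<le> dist x b" using w(1) by (auto simp: T_def)
      have wk: "infdist w P \<le> k" using w(2) k by linarith
      have dwz: "dist w z = \<bar>dist x w - dist x z\<bar>" by (rule segment_dist[OF S wS(1) z])
      have step: "infdist v P \<le> k" if "v \<in> S" "\<bar>dist x w - dist x v\<bar> = 1" for v
      proof -
        have "dist v w = 1" using segment_dist[OF S wS(1) that(1)] that(2) by (simp add: dist_commute)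
        then show ?thesis using infdist_triangle[of v P w] w(2) k by linarith
      qed
      have ends: "dist x z \<le> dist x y" using segment_dist_add[OF S z] zero_le_dist[of z y] by linarith
      \<comment> \<open>A point of \<open>N\<^sub>M(P)\<close> on the arc from \<open>a\<close> to \<open>b\<close> can only be one of its ends, and then
        the arc could be shortened by \<open>1\<close> there.\<close>
      show False
      proof (cases "dist x w \<le> dist x z")
        case True
        then have "dist x w \<le> dist x a" using a_max[of w] wS wk by simp
        have "0 \<le> dist x w + 1" "dist x w + 1 \<le> dist x y"
          using True far dwz ends zero_le_dist[of x w] by linarith+
        then obtain v where v: "v \<in> S" "dist x v = dist x w + 1"
          using segment_point[OF S] by blast
        have "dist x v \<le> dist x a" using a_max[of v] step[of v] v True far dwz by simp
        then show False using v \<open>dist x w \<le> dist x a\<close> wS by linarith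
      next
        case False
        then have "dist x b \<le> dist x w" using b_min[of w] wS wk by simp
        have "0 \<le> dist x w - 1" "dist x w - 1 \<le> dist x y"
          using segment_dist_add[OF S wS(1)] zero_le_dist[of w y] False far dwz zero_le_dist[of x z]
          by linarith+
        then obtain v where v: "v \<in> S" "dist x v = dist x w - 1"
          using segment_point[OF S] by blast
        have "dist x b \<le> dist x v" using b_min[of v] step[of v] v False far dwz by simp
        then show False using v \<open>dist x b \<le> dist x w\<close> wS by linarith
      qed
    qed
    moreover have "dist a z \<le> dist a b" using dab b by simp
    moreover have "infdist a P \<le> k" using a by simp
    ultimately have "infdist z P \<le> qhull K" using tri[of a] hk dist_commute[of z a] by linarith
    then show ?thesis by (simp only: mem)
  qed
qed

lemma between_in_hull:
  assumes "P \<in> \<P>" "geodesic_segment S a b" "g \<in> S" "z \<in> S" "h \<in> S"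
    "dist a g \<le> dist a z" "dist a z \<le> dist a h" "g \<in> nbhd K P" "h \<in> nbhd K P"
  shows "z \<in> nbhd (qhull K) P"
  by (rule segment_in_hull[OF assms(1) segment_sub[OF assms(2,3,5)] assms(8,9)])
    (use assms in auto)

definition shadow :: "real \<Rightarrow> real" where
  "shadow K = qhull K + 3 * \<delta> + 2 + B (qhull K + \<delta>)"

lemma shadow_nonneg: "0 \<le> shadow K"
  using qhull_ge(3)[of K] delta_nonneg B_nonneg[of "qhull K + \<delta>"] by (simp add: shadow_def)

text \<open>
  Consider the triangle \<open>x, p, y\<close>. Its side \<open>[p,y]\<close> stays near \<open>P\<close>, while \<open>[x,p]\<close> is near \<open>P\<close> only near
  \<open>p\<close>. So the pair of close points on these two sides is near \<open>p\<close>. The other pair on \<open>[p,y]\<close> is the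
  same in case (C), and close to it by \<open>(\<alpha>\<^sub>1)\<close> in case (P) with \<open>Q \<noteq> P\<close>. If \<open>Q = P\<close>, the point of
  \<open>[x,p]\<close> next to \<open>[y,x]\<close> is near \<open>P\<close> and so near \<open>p\<close>.
\<close>
lemma segment_meets_projection:
  assumes K: "0 \<le> K" and P: "P \<in> \<P>" and p: "coarse_projection P x p" and y: "y \<in> nbhd K P"
    and S: "geodesic_segment S x y"
  shows "\<exists>w\<in>S. dist w p \<le> shadow K"
proof -
  obtain U where U: "geodesic_segment U x p" using segment_ex by blast
  obtain T where T: "geodesic_segment T p y" using segment_ex by blast
  obtain e\<^sub>0 f\<^sub>0 e\<^sub>1 f\<^sub>1 e\<^sub>2 f\<^sub>2 where m: "e\<^sub>0 \<in> U" "f\<^sub>0 \<in> U" "e\<^sub>1 \<in> T" "f\<^sub>1 \<in> T" "e\<^sub>2 \<in> S" "f\<^sub>2 \<in> S"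
    and d: "dist f\<^sub>0 e\<^sub>1 \<le> \<delta>" "dist f\<^sub>1 e\<^sub>2 \<le> \<delta>" "dist f\<^sub>2 e\<^sub>0 \<le> \<delta>"
    and alt: "e\<^sub>0 = f\<^sub>0 \<and> e\<^sub>1 = f\<^sub>1 \<and> e\<^sub>2 = f\<^sub>2 \<or> (\<exists>Q\<in>\<P>. {e\<^sub>0, f\<^sub>0, e\<^sub>1, f\<^sub>1, e\<^sub>2, f\<^sub>2} \<subseteq> nbhd \<delta> Q)"
    using thin[OF U T segment_rev[OF S]] by blast
  have "p \<in> nbhd K P" using p K by (intro mem_nbhd) (auto simp: coarse_projection_def)
  then have ef: "e\<^sub>1 \<in> nbhd (qhull K) P" "f\<^sub>1 \<in> nbhd (qhull K) P"
    using segment_in_hull[OF P T] y m by auto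
  have "f\<^sub>0 \<in> nbhd (qhull K + \<delta>) P" using nbhd_step[OF ef(1), of f\<^sub>0 \<delta>] d by (simp add: dist_commute)
  then have f0: "dist f\<^sub>0 p \<le> qhull K + \<delta> + 2" by (rule coarse_projection_near[OF p U m(2)])
  have Bn: "0 \<le> B (qhull K + \<delta>)" by (rule B_nonneg)
  have hn: "1 \<le> qhull K" by (rule qhull_ge)
  have chain: "dist e\<^sub>2 p \<le> dist f\<^sub>1 e\<^sub>2 + dist e\<^sub>1 f\<^sub>1 + dist f\<^sub>0 e\<^sub>1 + dist f\<^sub>0 p"
    using dist_triangle[of e\<^sub>2 p f\<^sub>1] dist_triangle[of f\<^sub>1 p e\<^sub>1] dist_triangle[of e\<^sub>1 p f\<^sub>0]
    by (simp add: dist_commute)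
  consider "e\<^sub>1 = f\<^sub>1" | "{e\<^sub>0, f\<^sub>0, e\<^sub>1, f\<^sub>1, e\<^sub>2, f\<^sub>2} \<subseteq> nbhd \<delta> P"
    | Q where "Q \<in> \<P>" "Q \<noteq> P" "{e\<^sub>0, f\<^sub>0, e\<^sub>1, f\<^sub>1, e\<^sub>2, f\<^sub>2} \<subseteq> nbhd \<delta> Q"
    using alt by blast
  then show ?thesis
  proof cases
    case 1
    then have "dist e\<^sub>2 p \<le> shadow K" using chain d f0 Bn unfolding shadow_def by simp
    then show ?thesis using m by blast
  next
    case 2
    then have "dist e\<^sub>0 p \<le> \<delta> + 2" by (intro coarse_projection_near[OF p U m(1)]) auto
    then have "dist f\<^sub>2 p \<le> shadow K"
      using dist_triangle[of f\<^sub>2 p e\<^sub>0] d Bn hn delta_nonneg unfolding shadow_def by simp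
    then show ?thesis using m by blast
  next
    case 3
    then have "dist e\<^sub>1 f\<^sub>1 \<le> B (qhull K + \<delta>)"
      using ef hn delta_nonneg P by (intro overlap[of P Q]) (auto elim!: nbhd_mono)
    then have "dist e\<^sub>2 p \<le> shadow K" using chain d f0 unfolding shadow_def by simp
    then show ?thesis using m by blast
  qed
qed

lemma projection_detour:
  assumes "0 \<le> K" "P \<in> \<P>" "coarse_projection P x p" "y \<in> nbhd K P"
  shows "dist x p + dist p y \<le> dist x y + 2 * shadow K"
proof -
  obtain S where S: "geodesic_segment S x y" using segment_ex by blast
  obtain w where w: "w \<in> S" "dist w p \<le> shadow K" using segment_meets_projection[OF assms S] by blast
  show ?thesis
    using segment_dist_add[OF S w(1)] w(2) dist_triangle[of x p w] dist_triangle[of p y w]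
    by (simp add: dist_commute)
qed

section \<open>Points that are almost between the ends of a segment\<close>

definition drift :: "real \<Rightarrow> real" where
  "drift C = 2 * C + 4 * \<delta> + qhull \<delta>"

text \<open>
  Apply the triangle condition to \<open>a, x, b\<close>. As \<open>x\<close> is almost between \<open>a\<close> and \<open>b\<close>, the close points on
  the two sides at \<open>x\<close> are near \<open>x\<close>: the shortcut between them saves only a bounded length. In case (C)
  the third side is then near \<open>x\<close> as well. In case (P) the points \<open>u\<close> and \<open>v\<close> of \<open>S\<close> next to the other
  two sides lie near \<open>Q\<close>, and \<open>x\<close> is almost between \<open>u\<close> and \<open>v\<close>. The last two estimates say that \<open>x\<close>
  must be near \<open>z\<close> whenever \<open>z\<close> is near \<open>u\<close> or \<open>v\<close>.
\<close>
lemma drift_dichotomy: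
  assumes C: "0 \<le> C" and S: "geodesic_segment S a b" and z: "z \<in> S"
    and xz: "dist a x = dist a z" and x: "dist a x + dist x b \<le> dist a b + C"
    and far: "drift C < dist x z"
  obtains Q u v where "Q \<in> \<P>" "u \<in> S" "v \<in> S" "u \<in> nbhd (drift C) Q" "v \<in> nbhd (drift C) Q"
    "z \<in> nbhd (drift C) Q" "x \<in> nbhd (drift C) Q"
    "dist a u \<le> dist a z" "dist a z \<le> dist a v"
    "dist x u \<le> dist z u + drift C" "dist x v \<le> dist z v + drift C"
proof -
  obtain S\<^sub>0 where S0: "geodesic_segment S\<^sub>0 a x" using segment_ex by blast
  obtain S\<^sub>1 where S1: "geodesic_segment S\<^sub>1 x b" using segment_ex by blast
  obtain e\<^sub>0 f\<^sub>0 e\<^sub>1 f\<^sub>1 v u where m: "e\<^sub>0 \<in> S\<^sub>0" "f\<^sub>0 \<in> S\<^sub>0" "e\<^sub>1 \<in> S\<^sub>1" "f\<^sub>1 \<in> S\<^sub>1" "v \<in> S" "u \<in> S"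
    and d: "dist f\<^sub>0 e\<^sub>1 \<le> \<delta>" "dist f\<^sub>1 v \<le> \<delta>" "dist u e\<^sub>0 \<le> \<delta>"
    and alt: "e\<^sub>0 = f\<^sub>0 \<and> e\<^sub>1 = f\<^sub>1 \<and> v = u \<or> (\<exists>Q\<in>\<P>. {e\<^sub>0, f\<^sub>0, e\<^sub>1, f\<^sub>1, v, u} \<subseteq> nbhd \<delta> Q)"
    using thin[OF S0 S1 segment_rev[OF S]] by blast
  note S0d = segment_dist_add[OF S0] and S1d = segment_dist_add[OF S1] and Sd = segment_dist_add[OF S]
  have hn: "1 \<le> qhull \<delta>" by (rule qhull_ge)
  have f0: "dist f\<^sub>0 x \<le> C + \<delta>"
    using S0d[OF m(2)] S1d[OF m(3)] x d(1) dist_triangle[of a b f\<^sub>0] dist_triangle[of f\<^sub>0 b e\<^sub>1]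
    by (smt (verit) zero_le_dist)
  have uz: "dist u z = \<bar>dist a u - dist a z\<bar>" and vz: "dist v z = \<bar>dist a v - dist a z\<bar>"
    using segment_dist[OF S] m z by auto
  have ux: "dist a u + dist u x \<le> dist a z + 2 * \<delta>"
    using S0d[OF m(1)] d(3) xz dist_triangle[of a u e\<^sub>0] dist_triangle[of u x e\<^sub>0]
    by (simp add: dist_commute)
  have vx: "dist v b + dist v x \<le> dist z b + C + 2 * \<delta>"
    using S1d[OF m(4)] d(2) x xz Sd[OF z] dist_triangle[of v b f\<^sub>1] dist_triangle[of v x f\<^sub>1]
    by (simp add: dist_commute)
  have tri: "dist x z \<le> dist u x + dist u z" "dist x z \<le> dist v x + dist v z"
    using dist_triangle[of x z u] dist_triangle[of x z v] by (auto simp: dist_commute)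
  have u: "dist a u \<le> dist a z"
  proof (rule ccontr)
    assume "\<not> ?thesis"
    then have "dist x z \<le> 4 * \<delta>" using ux uz tri(1) zero_le_dist[of u x] by linarith
    then show False using far hn C by (simp add: drift_def)
  qed
  have v: "dist a z \<le> dist a v"
  proof (rule ccontr)
    assume "\<not> ?thesis"
    then have "dist x z \<le> 2 * C + 4 * \<delta>"
      using vx vz tri(2) Sd[OF z] Sd[OF m(5)] zero_le_dist[of v x] by linarith
    then show False using far hn by (simp add: drift_def)
  qed
  show thesis
  proof (cases "e\<^sub>0 = f\<^sub>0 \<and> v = u")
    case True
    then have eq: "dist e\<^sub>0 x = dist f\<^sub>0 x" "dist a v = dist a u" by simp_all
    have "dist u x \<le> C + 2 * \<delta>"
      using f0 d(3) eq(1) dist_triangle[of u x e\<^sub>0] by linarith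
    moreover have "dist u z = 0" using u v uz eq(2) by linarith
    ultimately show thesis using far hn C tri(1) delta_nonneg unfolding drift_def by linarith
  next
    case False
    then obtain Q where Q: "Q \<in> \<P>" "{e\<^sub>0, f\<^sub>0, e\<^sub>1, f\<^sub>1, v, u} \<subseteq> nbhd \<delta> Q" using alt by auto
    have "z \<in> nbhd (qhull \<delta>) Q"
      using between_in_hull[OF Q(1) S m(6) z m(5) u v] Q(2) by auto
    moreover have "x \<in> nbhd (C + 2 * \<delta>) Q" using nbhd_step[of f\<^sub>0 \<delta> Q x "C + \<delta>"] Q f0 by auto
    ultimately show thesis
      using Q m u v uz vz ux vx Sd[OF z] Sd[OF m(5)] C delta_nonneg hn
      by (intro that[of Q u v]) (auto simp: drift_def dist_commute elim!: nbhd_mono)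
  qed
qed

definition follow :: "real \<Rightarrow> real \<Rightarrow> real" where
  "follow C K = qhull (max K (drift C)) + drift C + 2 * B (qhull (max K (drift C))) + 1"

lemma follow_pos: assumes "0 \<le> C" shows "0 < follow C K"
  using qhull_ge(3)[of "max K (drift C)"] qhull_ge(3)[of \<delta>] B_nonneg[of "qhull (max K (drift C))"]
    delta_nonneg assms
  unfolding follow_def drift_def by linarith

text \<open>
  While \<open>S\<close> travels along \<open>Q\<close>, an almost-geodesic with the same ends does so too. If it drifts off along
  \<open>Q' \<noteq> Q\<close>, then the stretches of \<open>S\<close> along \<open>Q\<close> and along \<open>Q'\<close> both contain \<open>z\<close>, and their overlap
  is short by \<open>(\<alpha>\<^sub>1)\<close>. As the stretch along \<open>Q\<close> extends far beyond \<open>z\<close> on one side, that along \<open>Q'\<close>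
  ends near \<open>z\<close> on this side, and there the drift is small.
\<close>
lemma almost_between_follows:
  assumes C: "0 \<le> C" and Q: "Q \<in> \<P>" and S: "geodesic_segment S a b"
    and g: "g \<in> S" "g \<in> nbhd K Q" and h: "h \<in> S" "h \<in> nbhd K Q" and z: "z \<in> S"
    and ord: "dist a g \<le> dist a z" "dist a z \<le> dist a h"
    and long: "follow C K \<le> dist g z \<or> follow C K \<le> dist z h"
    and xz: "dist a x = dist a z" and x: "dist a x + dist x b \<le> dist a b + C"
  shows "x \<in> nbhd (follow C K) Q"
proof -
  define k k' where "k = max K (drift C)" and "k' = qhull k"
  have kk: "K \<le> k" "drift C \<le> k" "k \<le> k'" "1 \<le> k'"
    using qhull_ge[of k] unfolding k'_def by (auto simp: k_def)
  have fo: "follow C K = k' + drift C + 2 * B k' + 1" by (simp add: follow_def k_def k'_def)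
  have dr: "0 \<le> drift C" using qhull_ge(3)[of \<delta>] delta_nonneg C by (simp add: drift_def)
  have Bn: "0 \<le> B k'" by (rule B_nonneg)
  have gh: "g \<in> nbhd k Q" "h \<in> nbhd k Q" using g h kk nbhd_mono by blast+
  have zQ: "z \<in> nbhd k' Q"
    unfolding k'_def by (rule between_in_hull[OF Q S g(1) z h(1) ord gh])
  show ?thesis
  proof (cases "drift C < dist x z")
    case False
    then show ?thesis using nbhd_step[OF zQ, of x "drift C"] Bn fo by (simp add: dist_commute)
  next
    case True
    obtain Q' u v where Q': "Q' \<in> \<P>" and uv: "u \<in> S" "v \<in> S" "u \<in> nbhd (drift C) Q'" "v \<in> nbhd (drift C) Q'"
      and xQ: "x \<in> nbhd (drift C) Q'" and uzv: "dist a u \<le> dist a z" "dist a z \<le> dist a v"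
      and dx: "dist x u \<le> dist z u + drift C" "dist x v \<le> dist z v + drift C"
      by (rule drift_dichotomy[OF C S z xz x True])
    show ?thesis
    proof (cases "Q' = Q")
      case True
      then show ?thesis using xQ fo kk Bn by (auto elim!: nbhd_mono)
    next
      case False
      have uv': "u \<in> nbhd k Q'" "v \<in> nbhd k Q'" using uv kk nbhd_mono by blast+
      have close: "x \<in> nbhd (follow C K) Q" if "dist z w \<le> B k'" "dist x w \<le> dist z w + drift C" for w
        using nbhd_step[OF zQ, of x "2 * B k' + drift C" "follow C K"] that fo
          dist_triangle[of z x w] by (simp add: dist_commute)
      have qhull': "t \<in> nbhd k' Q" if "t \<in> S" "dist a g \<le> dist a t" "dist a t \<le> dist a h" for t
        unfolding k'_def by (rule between_in_hull[OF Q S g(1) that(1) h(1) that(2,3) gh])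
      have qhull'': "t \<in> nbhd k' Q'" if "t \<in> S" "dist a u \<le> dist a t" "dist a t \<le> dist a v" for t
        unfolding k'_def by (rule between_in_hull[OF Q' S uv(1) that(1) uv(2) that(2,3) uv'])
      have both: "dist z t \<le> B k'"
        if "t \<in> S" "dist a g \<le> dist a t" "dist a t \<le> dist a h" "dist a u \<le> dist a t" "dist a t \<le> dist a v" for t
        using overlap[OF Q Q' _ zQ qhull''[OF z uzv] qhull'[OF that(1-3)] qhull''[OF that(1,4,5)]] False by auto
      from long show ?thesis
      proof
        assume l: "follow C K \<le> dist g z"
        have "dist a g < dist a u"
          using both[of g] g l ord uzv fo kk dr Bn by (force simp: dist_commute)
        then show ?thesis using close[OF both dx(1)] uv uzv ord by auto
      next
        assume l: "follow C K \<le> dist z h"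
        have "dist a v < dist a h"
          using both[of h] h l ord uzv fo kk dr Bn by force
        then show ?thesis using close[OF both dx(2)] uv uzv ord by auto
      qed
    qed
  qed
qed

definition long :: "real \<Rightarrow> real \<Rightarrow> real" where
  "long C K = 4 * qhull K / \<epsilon> + 4 * follow C M"

lemma long_pos: assumes "0 \<le> C" shows "0 < long C K"
  using follow_pos[OF assms, of M] qhull_ge(3)[of K] eps_pos by (simp add: long_def add_nonneg_pos)

text \<open>
  The radius of the conclusion does not depend on \<open>K\<close>: a long geodesic with ends in \<open>N\<^sub>K(Q)\<close> meets
  \<open>N\<^sub>M(Q)\<close> in its first quarter and in its second half, by quasi-convexity and \<open>(\<alpha>\<^sub>2)\<close>. The midpoint
  lies between these two points and far from the first one.
\<close>
lemma midpoint_near_peripheral: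
  assumes C: "0 \<le> C" and Q: "Q \<in> \<P>" and a: "a \<in> nbhd K Q" and b: "b \<in> nbhd K Q"
    and long: "long C K \<le> dist a b"
    and x: "dist a x = dist a b / 2" "dist a x + dist x b \<le> dist a b + C"
  shows "x \<in> nbhd (follow C M) Q"
proof -
  obtain S where S: "geodesic_segment S a b" using segment_ex by blast
  obtain t where t: "t \<in> S" "dist a t = dist a b / 4"
    using segment_point[OF S, of "dist a b / 4"] by auto
  obtain z where z: "z \<in> S" "dist a z = dist a b / 2"
    using segment_point[OF S, of "dist a b / 2"] by auto
  have fp: "0 < follow C M" using follow_pos[OF C] .
  have "4 * qhull K / \<epsilon> \<le> dist a b" using long fp by (simp add: long_def)
  then have eps: "qhull K \<le> \<epsilon> * (dist a b / 4)" using eps_pos by (simp add: field_simps)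
  moreover have "0 \<le> \<epsilon> * (dist a b / 4)" using eps_pos by simp
  ultimately have eps': "qhull K \<le> \<epsilon> * (dist a b / 2)" by (simp add: field_simps)
  have fd: "follow C M \<le> dist a b / 4"
  proof -
    have "0 \<le> 4 * qhull K / \<epsilon>" using qhull_ge(3)[of K] eps_pos by simp
    then show ?thesis using long by (simp add: long_def)
  qed
  have tz: "t \<in> nbhd (qhull K) Q" "z \<in> nbhd (qhull K) Q"
    using segment_in_hull[OF Q S a b] t z by auto
  have ab: "a \<in> nbhd (qhull K) Q" "b \<in> nbhd (qhull K) Q"
    using a b qhull_ge(1)[of K] by (auto elim!: nbhd_mono)
  have bz: "dist z b = dist a b / 2" using segment_dist_add[OF S z(1)] z(2) by linarith
  obtain g where g: "g \<in> S" "dist a g \<le> dist a t" "g \<in> nbhd M Q"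
    using penetrate[OF Q segment_init[OF S t(1)]] tz ab eps nbhd_mono unfolding t(2) by blast
  obtain h where h: "h \<in> S" "dist a z \<le> dist a h" "h \<in> nbhd M Q"
  proof -
    have ord: "dist a z \<le> dist a b" using z(2) zero_le_dist[of a b] by linarith
    have "z \<in> nbhd (\<epsilon> * dist z b) Q" "b \<in> nbhd (\<epsilon> * dist z b) Q"
      using tz(2) ab(2) eps' unfolding bz by (auto elim: nbhd_mono)
    from penetrate[OF Q segment_sub[OF S z(1) segment_end(2)[OF S] ord] this] show ?thesis
      using that by blast
  qed
  have "follow C M \<le> dist g z" using segment_dist[OF S g(1) z(1)] g(2) t z fd by linarith
  moreover have "dist a g \<le> dist a z" using g(2) t z zero_le_dist[of a b] by linarith
  moreover have "dist a x = dist a z" using x z by simp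
  ultimately show ?thesis
    using almost_between_follows[OF C Q S g(1,3) h(1,3) z(1)] h(2) x(2) by blast
qed

section \<open>Two points with distant projections\<close>

definition gap :: real where
  "gap = 2 * shadow 0 + 2 * \<delta> + qhull (shadow 0) + B (qhull (shadow 0) + qhull \<delta>) + 3"

definition approach :: real where
  "approach = qhull (shadow 0) + \<delta>"

lemma approach_nonneg: "0 \<le> approach"
  using qhull_ge(3)[of "shadow 0"] delta_nonneg by (simp add: approach_def)

text \<open>
  In the triangle \<open>p, q, q'\<close> the side \<open>T\<close> from \<open>q'\<close> to \<open>p\<close> passes near \<open>p'\<close> at a point \<open>w\<close>. Points of
  \<open>[q,q']\<close> can only be close to points of \<open>T\<close> between \<open>q'\<close> and \<open>w\<close>, since otherwise \<open>p'\<close> would be a much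
  better projection of \<open>q\<close> than \<open>q'\<close>. This part of \<open>T\<close> lies near \<open>Q\<close>. If the point \<open>f\<^sub>2\<close> of \<open>T\<close> next to
  \<open>S\<close> is in it, we are done. If not, \<open>T\<close> travels along some \<open>Q'\<close> from \<open>e\<^sub>2\<close> to \<open>f\<^sub>2\<close> through \<open>w\<close>. For
  \<open>Q' \<noteq> Q\<close>, \<open>(\<alpha>\<^sub>1)\<close> then puts \<open>e\<^sub>2\<close> near \<open>w\<close>, so that \<open>[q,q']\<close> comes near \<open>p'\<close> although it is near \<open>Q\<close>
  only near \<open>q'\<close>.
\<close>
lemma segment_meets_nbhd:
  assumes Q: "Q \<in> \<P>" and p': "coarse_projection Q p p'" and q': "coarse_projection Q q q'"
    and far: "gap < dist p' q'" and S: "geodesic_segment S p q"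
  shows "\<exists>e\<in>S. e \<in> nbhd approach Q"
proof -
  define R H where "R = shadow 0" and "H = qhull (shadow 0)"
  have R: "0 \<le> R" unfolding R_def by (rule shadow_nonneg)
  have H: "R + 1 \<le> H" "1 \<le> H" unfolding H_def R_def by (rule qhull_ge)+
  have hd: "\<delta> + 1 \<le> qhull \<delta>" by (rule qhull_ge)
  have Bn: "0 \<le> B (H + qhull \<delta>)" by (rule B_nonneg)
  have far: "2 * R + 2 * \<delta> + H + B (H + qhull \<delta>) + 3 < dist p' q'"
    using far unfolding gap_def R_def H_def .
  have PQ: "p' \<in> Q" "q' \<in> Q" using p' q' by (auto simp: coarse_projection_def)
  have q0: "q' \<in> nbhd 0 Q" "q' \<in> nbhd R Q" using mem_nbhd[OF PQ(2)] R by auto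
  obtain U where U: "geodesic_segment U q q'" using segment_ex by blast
  obtain T where T: "geodesic_segment T q' p" using segment_ex by blast
  obtain w where w: "w \<in> T" "dist w p' \<le> R"
    using segment_meets_projection[OF _ Q p' q0(1) segment_rev[OF T]] unfolding R_def by auto
  have wQ: "w \<in> nbhd R Q"
    using nbhd_step[OF mem_nbhd[OF PQ(1), of 0], of w R R] w(2) by (simp add: dist_commute)
  have TQ: "t \<in> nbhd H Q" if "t \<in> T" "dist q' t \<le> dist q' w" for t
    using between_in_hull[OF Q T segment_end(1)[OF T] that(1) w(1) _ that(2) q0(2) wQ]
    by (simp add: H_def R_def)
  \<comment> \<open>If \<open>t\<close> were beyond \<open>w\<close>, then from \<open>s\<close>, and so from \<open>q\<close>, the point \<open>p'\<close> would be closer than \<open>q'\<close>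
    by almost \<open>d(p',q')\<close>.\<close>
  have side: "dist q' t < dist q' w" if t: "t \<in> T" and s: "s \<in> U" and st: "dist s t \<le> \<delta>" for s t
  proof (rule ccontr)
    assume "\<not> ?thesis"
    then have tw: "dist q' t = dist q' w + dist t w" using segment_dist[OF T t w(1)] by simp
    have "dist q q' \<le> dist q p' + 1" using q' PQ by (auto simp: coarse_projection_def)
    then have "dist s q' \<le> dist s p' + 1"
      using segment_dist_add[OF U s] dist_triangle[of q p' s] by linarith
    then have "dist t q' \<le> dist t w + R + 1 + 2 * \<delta>"
      using st w(2) dist_triangle[of t q' s] dist_triangle[of s p' t] dist_triangle[of t p' w]
      by (simp add: dist_commute)
    then have "dist p' q' \<le> 2 * R + 1 + 2 * \<delta>"
      using tw w(2) dist_triangle[of p' q' w] by (simp add: dist_commute)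
    then show False using far H Bn by linarith
  qed
  obtain e\<^sub>0 f\<^sub>0 e\<^sub>1 f\<^sub>1 e\<^sub>2 f\<^sub>2 where m: "e\<^sub>0 \<in> S" "f\<^sub>0 \<in> S" "e\<^sub>1 \<in> U" "f\<^sub>1 \<in> U" "e\<^sub>2 \<in> T" "f\<^sub>2 \<in> T"
    and d: "dist f\<^sub>0 e\<^sub>1 \<le> \<delta>" "dist f\<^sub>1 e\<^sub>2 \<le> \<delta>" "dist f\<^sub>2 e\<^sub>0 \<le> \<delta>"
    and alt: "e\<^sub>0 = f\<^sub>0 \<and> e\<^sub>1 = f\<^sub>1 \<and> e\<^sub>2 = f\<^sub>2 \<or> (\<exists>Q\<in>\<P>. {e\<^sub>0, f\<^sub>0, e\<^sub>1, f\<^sub>1, e\<^sub>2, f\<^sub>2} \<subseteq> nbhd \<delta> Q)"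
    using thin[OF S U T] by blast
  have e2: "dist q' e\<^sub>2 < dist q' w" by (rule side[OF m(5,4) d(2)])
  then have e2Q: "e\<^sub>2 \<in> nbhd H Q" using TQ[OF m(5)] by simp
  have via_f2: ?thesis if "dist q' f\<^sub>2 \<le> dist q' w"
    using nbhd_step[OF TQ[OF m(6) that] d(3), of approach] m by (auto simp: approach_def H_def)
  consider "e\<^sub>2 = f\<^sub>2" | "{e\<^sub>0, f\<^sub>0, e\<^sub>1, f\<^sub>1, e\<^sub>2, f\<^sub>2} \<subseteq> nbhd \<delta> Q"
    | Q' where "Q' \<in> \<P>" "Q' \<noteq> Q" "{e\<^sub>0, f\<^sub>0, e\<^sub>1, f\<^sub>1, e\<^sub>2, f\<^sub>2} \<subseteq> nbhd \<delta> Q'"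
    using alt by blast
  then show ?thesis
  proof cases
    case 1 then show ?thesis using via_f2 e2 by simp
  next
    case 2 then show ?thesis
      using m H by (intro bexI[of _ e\<^sub>0]) (auto simp: approach_def H_def elim!: nbhd_mono)
  next
    case 3
    show ?thesis
    proof (rule via_f2, rule ccontr)
      assume "\<not> dist q' f\<^sub>2 \<le> dist q' w"
      then have "w \<in> nbhd (qhull \<delta>) Q'"
        using between_in_hull[OF 3(1) T m(5) w(1) m(6)] 3(3) e2 by auto
      then have "dist w e\<^sub>2 \<le> B (H + qhull \<delta>)"
        using 3 Q wQ e2Q H R hd delta_nonneg by (intro overlap[of Q Q']) (auto elim!: nbhd_mono)
      moreover have "f\<^sub>1 \<in> nbhd (H + \<delta>) Q"
        using nbhd_step[OF e2Q, of f\<^sub>1 \<delta>] d by (simp add: dist_commute)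
      then have "dist f\<^sub>1 q' \<le> H + \<delta> + 2" by (rule coarse_projection_near[OF q' U m(4)])
      ultimately have "dist p' q' \<le> R + B (H + qhull \<delta>) + \<delta> + (H + \<delta> + 2)"
        using w(2) d(2) dist_triangle[of p' q' w] dist_triangle[of w q' e\<^sub>2] dist_triangle[of e\<^sub>2 q' f\<^sub>1]
        by (simp add: dist_commute)
      then show False using far R by linarith
    qed
  qed
qed

definition far :: "real \<Rightarrow> real" where
  "far C = gap + 2 * shadow approach + follow C (shadow approach)"

text \<open>
  A point of the geodesic near \<open>Q\<close> cuts it into two geodesics to \<open>Q\<close>, which pass near \<open>p'\<close> and near
  \<open>q'\<close>. So the geodesic has a long stretch along \<open>Q\<close>, and \<open>r\<close> is the distance from \<open>p\<close> to its first point.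
\<close>
lemma far_projections:
  assumes C: "0 \<le> C" and Q: "Q \<in> \<P>" and p': "coarse_projection Q p p'" and q': "coarse_projection Q q q'"
    and far: "far C < dist p' q'"
  shows "\<exists>r\<ge>0. r \<le> dist p q \<and> (\<forall>x. dist p x = r \<and> dist p x + dist x q \<le> dist p q + C
    \<longrightarrow> x \<in> nbhd (follow C (shadow approach)) Q)"
proof -
  let ?R = "shadow approach"
  have pos: "0 < follow C ?R" "0 \<le> ?R" using follow_pos[OF C] shadow_nonneg by auto
  have PQ: "p' \<in> Q" "q' \<in> Q" using p' q' by (auto simp: coarse_projection_def)
  obtain S where S: "geodesic_segment S p q" using segment_ex by blast
  obtain e where e: "e \<in> S" "e \<in> nbhd approach Q"
    using segment_meets_nbhd[OF Q p' q' _ S] far pos by (auto simp: far_def)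
  obtain g where g: "g \<in> S" "dist g p' \<le> ?R"
    using segment_meets_projection[OF approach_nonneg Q p' e(2) segment_init[OF S e(1)]] by blast
  obtain h where h: "h \<in> S" "dist h q' \<le> ?R"
    using segment_meets_projection[OF approach_nonneg Q q' e(2) segment_init[OF segment_rev[OF S] e(1)]] by blast
  have ghQ: "g \<in> nbhd ?R Q" "h \<in> nbhd ?R Q"
    using nbhd_step[OF mem_nbhd[OF PQ(1), of 0], of g ?R ?R] nbhd_step[OF mem_nbhd[OF PQ(2), of 0], of h ?R ?R] g h
    by (auto simp: dist_commute)
  have gap: "0 \<le> gap"
    using shadow_nonneg[of 0] delta_nonneg qhull_ge(3)[of "shadow 0"] B_nonneg[of "qhull (shadow 0) + qhull \<delta>"]
    unfolding gap_def by linarith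
  have gh: "follow C ?R \<le> dist g h"
    using far gap g h dist_triangle[of p' q' g] dist_triangle[of g q' h] unfolding far_def
    by (simp add: dist_commute)
  have *: ?thesis if s: "s \<in> S" "s \<in> nbhd ?R Q" and t: "t \<in> S" "t \<in> nbhd ?R Q"
    and st: "dist p s \<le> dist p t" "follow C ?R \<le> dist s t" for s t
    using almost_between_follows[OF C Q S s t s(1) _ st(1)] st segment_dist_add[OF S s(1)]
    by (intro exI[of _ "dist p s"]) (auto simp: dist_commute, smt (verit) zero_le_dist)
  show ?thesis
  proof (cases "dist p g \<le> dist p h")
    case True then show ?thesis using *[of g h] g h ghQ gh by simp
  next
    case False then show ?thesis using *[of h g] g h ghQ gh by (simp add: dist_commute)
  qed
qed

section \<open>Almost straight paths near members of the family\<close>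

lemma far_projections_meet:
  assumes C: "0 \<le> C" and Q: "Q \<in> \<P>" and \<alpha>: "almost_straight C \<alpha> L"
    and p: "coarse_projection Q (\<alpha> 0) p" and q: "coarse_projection Q (\<alpha> L) q"
    and far: "far C < dist p q" and \<sigma>: "follow C (shadow approach) \<le> \<sigma>"
  shows "\<exists>t\<in>{0..L}. \<alpha> t \<in> nbhd \<sigma> Q"
proof -
  obtain r where r: "0 \<le> r" "r \<le> dist (\<alpha> 0) (\<alpha> L)"
    and near: "\<And>x. dist (\<alpha> 0) x = r \<Longrightarrow> dist (\<alpha> 0) x + dist x (\<alpha> L) \<le> dist (\<alpha> 0) (\<alpha> L) + C
      \<Longrightarrow> x \<in> nbhd (follow C (shadow approach)) Q"
    using far_projections[OF C Q p q far] by blast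
  have "0 \<le> L" using \<alpha> by (simp add: almost_straight_def)
  then obtain t where "t \<in> {0..L}" "\<alpha> t \<in> nbhd (follow C (shadow approach)) Q"
    using almost_straight_point[OF \<alpha> _ _ _ r] near by auto
  then show ?thesis using \<sigma> nbhd_mono by blast
qed

definition entry :: "real \<Rightarrow> real \<Rightarrow> real" where
  "entry C \<sigma> = shadow \<sigma> + follow C (\<sigma> + shadow \<sigma>) + long C (follow C (\<sigma> + shadow \<sigma>) + \<sigma>)"

text \<open>
  The geodesic \<open>S\<close> from the start to the entrance point \<open>e\<close> passes near \<open>p\<close> at a point \<open>z\<close>. If \<open>z\<close> is far
  from \<open>e\<close>, then \<open>S\<close> travels along \<open>Q\<close> from \<open>z\<close> to \<open>e\<close>, and the point \<open>\<alpha> s\<close> of the path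
  corresponding to \<open>z\<close> lies in some, possibly much larger, neighbourhood of \<open>Q\<close>. If \<open>\<alpha> s\<close> is far
  from \<open>e\<close>, then by \<open>midpoint_near_peripheral\<close> the path meets the \<open>\<sigma>\<close>-neighbourhood of \<open>Q\<close>
  strictly before \<open>e\<close>, which is impossible.
\<close>
lemma entrance_near_projection:
  assumes C: "0 \<le> C" and Q: "Q \<in> \<P>" and \<alpha>: "almost_straight C \<alpha> L"
    and p: "coarse_projection Q (\<alpha> 0) p" and \<sigma>: "follow C M \<le> \<sigma>"
    and e: "is_entrance_point \<alpha> L (nbhd \<sigma> Q) e"
  shows "dist e p \<le> entry C \<sigma>"
proof -
  define R F where "R = shadow \<sigma>" and "F = follow C (\<sigma> + shadow \<sigma>)"
  have pos: "0 \<le> R" "0 < F" "0 < \<sigma>" "0 < long C (F + \<sigma>)"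
    using shadow_nonneg follow_pos[OF C] \<sigma> long_pos[OF C] unfolding R_def F_def
    by (auto intro: less_le_trans)
  have entry: "entry C \<sigma> = R + F + long C (F + \<sigma>)" by (simp add: entry_def R_def F_def)
  obtain t where t: "0 \<le> t" "t \<le> L" "\<alpha> t = e" "e \<in> nbhd \<sigma> Q"
    and first: "\<And>s. 0 \<le> s \<Longrightarrow> s \<le> L \<Longrightarrow> \<alpha> s \<in> nbhd \<sigma> Q \<Longrightarrow> t \<le> s"
    using e unfolding is_entrance_point_def by auto
  obtain S where S: "geodesic_segment S (\<alpha> 0) e" using segment_ex by blast
  obtain z where z: "z \<in> S" "dist z p \<le> R"
    using segment_meets_projection[OF less_imp_le[OF pos(3)] Q p t(4) S] unfolding R_def by blast
  have zQ: "z \<in> nbhd (\<sigma> + R) Q"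
    using nbhd_step[OF mem_nbhd[of p Q 0], of z R] z(2) p pos
    by (simp add: coarse_projection_def dist_commute)
  have eQ: "e \<in> nbhd (\<sigma> + R) Q" using t(4) pos by (auto elim: nbhd_mono)
  have ez: "dist e p \<le> dist z e + R" using z(2) dist_triangle[of e p z] by (simp add: dist_commute)
  have Sz: "dist (\<alpha> 0) z + dist z e = dist (\<alpha> 0) e" by (rule segment_dist_add[OF S z(1)])
  show ?thesis
  proof (cases "F \<le> dist z e")
    case False
    then show ?thesis using ez entry pos by linarith
  next
    case True
    have ze: "dist (\<alpha> 0) z \<le> dist (\<alpha> 0) e" using Sz zero_le_dist[of z e] by linarith
    then have "dist (\<alpha> 0) z \<le> dist (\<alpha> 0) (\<alpha> t)" using t(3) by simp
    then obtain s where s: "0 \<le> s" "s \<le> t" "dist (\<alpha> 0) (\<alpha> s) = dist (\<alpha> 0) z"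
      "dist (\<alpha> 0) (\<alpha> s) + dist (\<alpha> s) e \<le> dist (\<alpha> 0) e + C"
      using almost_straight_point[OF \<alpha> order_refl t(1,2) zero_le_dist, of "\<alpha> 0" z] t(3)
      by (metis atLeastAtMost_iff)
    have "\<alpha> s \<in> nbhd F Q"
      unfolding F_def R_def[symmetric]
      using almost_between_follows[OF C Q S z(1) zQ segment_end(2)[OF S] eQ z(1) order_refl ze _ s(3,4)]
        True by (simp add: F_def R_def)
    then have xQ: "\<alpha> s \<in> nbhd (F + \<sigma>) Q" using pos by (auto elim: nbhd_mono)
    have eQ': "\<alpha> t \<in> nbhd (F + \<sigma>) Q" using t(3,4) pos by (auto elim: nbhd_mono)
    have "dist (\<alpha> s) (\<alpha> t) < long C (F + \<sigma>)"
    proof (rule ccontr)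
      assume long: "\<not> ?thesis"
      have "0 \<le> dist (\<alpha> s) (\<alpha> t) / 2" "dist (\<alpha> s) (\<alpha> t) / 2 \<le> dist (\<alpha> s) (\<alpha> t)" by auto
      then obtain u where u: "s \<le> u" "u \<le> t" "dist (\<alpha> s) (\<alpha> u) = dist (\<alpha> s) (\<alpha> t) / 2"
        "dist (\<alpha> s) (\<alpha> u) + dist (\<alpha> u) (\<alpha> t) \<le> dist (\<alpha> s) (\<alpha> t) + C"
        using almost_straight_point[OF \<alpha> s(1,2) t(2)] by (metis atLeastAtMost_iff)
      have "\<alpha> u \<in> nbhd (follow C M) Q"
        using midpoint_near_peripheral[OF C Q xQ eQ' _ u(3,4)] long by simp
      then have "u = t" using first[of u] u(1,2) s(1) t(2) \<sigma> nbhd_mono by force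
      then show False using u(3) long pos(4) by simp
    qed
    moreover have "dist z e \<le> dist (\<alpha> s) (\<alpha> t)"
      using Sz s(3) t(3) dist_triangle[of "\<alpha> 0" e "\<alpha> s"] by simp
    ultimately show ?thesis using ez entry pos by linarith
  qed
qed

section \<open>Triangles\<close>

text \<open>
  The vertices \<open>V 0\<close>, \<open>V 1\<close>, \<open>V 2\<close> have projections to \<open>Q\<close> with pairwise distances above \<open>D\<close>. This is
  what decides between the two cases for a triangle of almost-geodesics.
\<close>
definition spread :: "real \<Rightarrow> 'a set \<Rightarrow> (nat \<Rightarrow> 'a) \<Rightarrow> bool" where
  "spread D Q V \<longleftrightarrow> (\<exists>\<pi>. (\<forall>i<3. coarse_projection Q (V i) (\<pi> i)) \<and>
     (\<forall>i<3. D < dist (\<pi> i) (\<pi> (Suc i mod 3))))"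

text \<open>
  If the geodesic triangle is in case (P) for \<open>Q\<close>, every side comes near \<open>Q\<close> and therefore passes near
  the projections of both its ends. Two of the three projections are close together, and each side
  has one of these two vertices as an end.
\<close>
lemma common_point:
  assumes S: "\<And>i. i < 3 \<Longrightarrow> geodesic_segment (S i) (V i) (V (Suc i mod 3))"
    and D: "0 \<le> D" and no: "\<And>Q. Q \<in> \<P> \<Longrightarrow> \<not> spread D Q V"
  shows "\<exists>a z. \<forall>i<3. z i \<in> S i \<and> dist (z i) a \<le> \<delta> + shadow \<delta> + D"
proof -
  have three: "i = 0 \<or> i = 1 \<or> i = 2" if "i < 3" for i :: nat using that by auto
  have S': "geodesic_segment (S 0) (V 0) (V 1)" "geodesic_segment (S 1) (V 1) (V 2)"
    "geodesic_segment (S 2) (V 2) (V 0)"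
    using S[of 0] S[of 1] S[of 2] by (simp_all add: numeral_2_eq_2)
  have sh: "0 \<le> shadow \<delta>" by (rule shadow_nonneg)
  obtain e\<^sub>0 f\<^sub>0 e\<^sub>1 f\<^sub>1 e\<^sub>2 f\<^sub>2 where
    m: "e\<^sub>0 \<in> S 0" "f\<^sub>0 \<in> S 0" "e\<^sub>1 \<in> S 1" "f\<^sub>1 \<in> S 1" "e\<^sub>2 \<in> S 2" "f\<^sub>2 \<in> S 2"
    and d: "dist f\<^sub>0 e\<^sub>1 \<le> \<delta>" "dist f\<^sub>1 e\<^sub>2 \<le> \<delta>" "dist f\<^sub>2 e\<^sub>0 \<le> \<delta>"
    and alt: "e\<^sub>0 = f\<^sub>0 \<and> e\<^sub>1 = f\<^sub>1 \<and> e\<^sub>2 = f\<^sub>2 \<or> (\<exists>Q\<in>\<P>. {e\<^sub>0, f\<^sub>0, e\<^sub>1, f\<^sub>1, e\<^sub>2, f\<^sub>2} \<subseteq> nbhd \<delta> Q)"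
    using thin[OF S'] by blast
  have "\<exists>a. \<forall>i<3. \<exists>z. z \<in> S i \<and> dist z a \<le> \<delta> + shadow \<delta> + D"
  proof (cases "e\<^sub>0 = f\<^sub>0 \<and> e\<^sub>1 = f\<^sub>1 \<and> e\<^sub>2 = f\<^sub>2")
    case True
    have le: "\<delta> \<le> \<delta> + shadow \<delta> + D" "0 \<le> \<delta> + shadow \<delta> + D" using sh D delta_nonneg by auto
    have "dist e\<^sub>0 e\<^sub>0 \<le> \<delta> + shadow \<delta> + D" "dist e\<^sub>1 e\<^sub>0 \<le> \<delta> + shadow \<delta> + D"
      "dist e\<^sub>2 e\<^sub>0 \<le> \<delta> + shadow \<delta> + D"
      using True d le by (auto simp: dist_commute)
    then show ?thesis using three m by blast
  next
    case False
    then obtain Q where Q: "Q \<in> \<P>" "{e\<^sub>0, f\<^sub>0, e\<^sub>1, f\<^sub>1, e\<^sub>2, f\<^sub>2} \<subseteq> nbhd \<delta> Q" using alt by blast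
    have "\<forall>i. \<exists>p. coarse_projection Q (V i) p"
      using Q(2) by (intro allI coarse_projection_ex) (auto simp: nbhd_def)
    then obtain \<pi> where \<pi>: "\<And>i. coarse_projection Q (V i) (\<pi> i)" by metis
    then obtain j where j: "j < 3" "dist (\<pi> j) (\<pi> (Suc j mod 3)) \<le> D"
      using no[OF Q(1)] unfolding spread_def by (metis not_less)
    have near: "\<exists>z\<in>S i. dist z (\<pi> i) \<le> shadow \<delta>" "\<exists>z\<in>S i. dist z (\<pi> (Suc i mod 3)) \<le> shadow \<delta>"
      if i: "i < 3" for i
    proof -
      obtain e where e: "e \<in> S i" "e \<in> nbhd \<delta> Q" using three[OF i] Q(2) m by auto
      show "\<exists>z\<in>S i. dist z (\<pi> i) \<le> shadow \<delta>"
        using segment_meets_projection[OF delta_nonneg Q(1) \<pi> e(2) segment_init[OF S[OF i] e(1)]] by blast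
      show "\<exists>z\<in>S i. dist z (\<pi> (Suc i mod 3)) \<le> shadow \<delta>"
        using segment_meets_projection[OF delta_nonneg Q(1) \<pi> e(2)
            segment_init[OF segment_rev[OF S[OF i]] e(1)]] by blast
    qed
    have "\<exists>z. z \<in> S i \<and> dist z (\<pi> j) \<le> \<delta> + shadow \<delta> + D" if i: "i < 3" for i
    proof -
      have "i = j \<or> i = Suc j mod 3 \<or> Suc i mod 3 = j" using three[OF i] three[OF j(1)] by auto
      then obtain k where k: "k = j \<or> k = Suc j mod 3" "\<exists>z\<in>S i. dist z (\<pi> k) \<le> shadow \<delta>"
        using near[OF i] by blast
      then obtain z where z: "z \<in> S i" "dist z (\<pi> k) \<le> shadow \<delta>" by blast
      have "dist (\<pi> k) (\<pi> j) \<le> D" using k(1) j(2) D by (auto simp: dist_commute)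
      then show ?thesis
        using z dist_triangle[of z "\<pi> j" "\<pi> k"] delta_nonneg by (intro exI[of _ z]) auto
    qed
    then show ?thesis by blast
  qed
  then obtain a where "\<forall>i. \<exists>z. i < 3 \<longrightarrow> z \<in> S i \<and> dist z a \<le> \<delta> + shadow \<delta> + D" by blast
  then show ?thesis by metis
qed

definition wander :: "real \<Rightarrow> real \<Rightarrow> real \<Rightarrow> real" where
  "wander C r D = drift C + 2 * (shadow (drift C) + 2 * r + 4 * shadow (drift C + 2 * r) + D)"

text \<open>
  The \<open>i\<close>-th side travels along some \<open>Q\<close> for a long time before and after \<open>z i\<close>, so \<open>z i\<close> is far from the
  projections of \<open>V i\<close> and \<open>V (i + 1)\<close> to \<open>Q\<close>. The point \<open>z j\<close> of any side is near \<open>z i\<close>, hence near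
  \<open>Q\<close>, so the two halves of the side run from the vertices past their projections to \<open>z j\<close>. As the side
  is a geodesic, the distance between the two projections is almost the sum of their distances to
  \<open>z j\<close>. One end of the side is \<open>V i\<close> or \<open>V (i + 1)\<close>, so this sum is large.
\<close>
lemma wander_spread:
  assumes C: "0 \<le> C" and D: "0 \<le> D" and r: "0 \<le> r"
    and S: "\<And>i. i < 3 \<Longrightarrow> geodesic_segment (S i) (V i) (V (Suc i mod 3))"
    and z: "\<And>i. i < 3 \<Longrightarrow> z i \<in> S i" "\<And>i. i < 3 \<Longrightarrow> dist (z i) a \<le> r"
    and i: "i < 3" and xz: "dist (V i) x = dist (V i) (z i)"
    and x: "dist (V i) x + dist x (V (Suc i mod 3)) \<le> dist (V i) (V (Suc i mod 3)) + C"
    and wander: "wander C r D < dist x (z i)"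
  shows "\<exists>Q\<in>\<P>. spread D Q V"
proof -
  define \<kappa> R where "\<kappa> = drift C" and "R = shadow (drift C + 2 * r)"
  have three: "i = 0 \<or> i = 1 \<or> i = 2" if "i < 3" for i :: nat using that by auto
  have \<kappa>: "0 \<le> \<kappa>" using qhull_ge(3)[of \<delta>] delta_nonneg C by (simp add: drift_def \<kappa>_def)
  have sh: "0 \<le> shadow \<kappa>" "0 \<le> R" unfolding R_def by (rule shadow_nonneg)+
  have w: "\<kappa> + 2 * (shadow \<kappa> + 2 * r + 4 * R + D) < dist x (z i)"
    using wander by (simp add: wander_def \<kappa>_def R_def)
  have "\<kappa> < dist x (z i)" by (rule le_less_trans[OF _ w]) (use sh D r in simp)
  then have w': "drift C < dist x (z i)" by (simp only: \<kappa>_def)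
  obtain Q u v where Q: "Q \<in> \<P>" and uv: "u \<in> S i" "v \<in> S i" "u \<in> nbhd \<kappa> Q" "v \<in> nbhd \<kappa> Q"
    and zQ: "z i \<in> nbhd \<kappa> Q"
    and ord: "dist (V i) u \<le> dist (V i) (z i)" "dist (V i) (z i) \<le> dist (V i) v"
    and dx: "dist x u \<le> dist (z i) u + \<kappa>" "dist x v \<le> dist (z i) v + \<kappa>"
    unfolding \<kappa>_def by (rule drift_dichotomy[OF C S[OF i] z(1)[OF i] xz x w'])
  have "\<forall>i. \<exists>p. coarse_projection Q (V i) p"
    using zQ by (intro allI coarse_projection_ex) (auto simp: nbhd_def)
  then obtain \<pi> where \<pi>: "\<And>i. coarse_projection Q (V i) (\<pi> i)" by metis
  define E where "E = 2 * r + 4 * R + D"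
  have far_uv: "shadow \<kappa> + E < dist u (z i)" "shadow \<kappa> + E < dist v (z i)"
    using dx w dist_triangle[of x "z i" u] dist_triangle[of x "z i" v] unfolding E_def
    by (simp_all add: dist_commute)
  have zd: "dist (z i) t = \<bar>dist (V i) t - dist (V i) (z i)\<bar>" if "t \<in> S i" for t
    using segment_dist[OF S[OF i] that z(1)[OF i]] by (simp add: dist_commute)
  have end1: "E < dist (\<pi> i) (z i)"
  proof -
    obtain t where t: "t \<in> S i" "dist (V i) t \<le> dist (V i) u" "dist t (\<pi> i) \<le> shadow \<kappa>"
      using segment_meets_projection[OF \<kappa> Q \<pi> uv(3) segment_init[OF S[OF i] uv(1)]] by blast
    have "dist u (z i) \<le> dist t (z i)"
      using zd[OF t(1)] zd[OF uv(1)] t(2) ord by (simp add: dist_commute)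
    then show ?thesis
      using far_uv t(3) dist_triangle[of t "z i" "\<pi> i"] by linarith
  qed
  have end2: "E < dist (\<pi> (Suc i mod 3)) (z i)"
  proof -
    obtain t where t: "t \<in> S i" "dist (V (Suc i mod 3)) t \<le> dist (V (Suc i mod 3)) v"
      "dist t (\<pi> (Suc i mod 3)) \<le> shadow \<kappa>"
      using segment_meets_projection[OF \<kappa> Q \<pi> uv(4) segment_init[OF segment_rev[OF S[OF i]] uv(2)]] by blast
    have "dist (V i) v \<le> dist (V i) t"
      using t(2) segment_dist_add[OF S[OF i] t(1)] segment_dist_add[OF S[OF i] uv(2)]
      by (simp add: dist_commute)
    then have "dist v (z i) \<le> dist t (z i)"
      using zd[OF t(1)] zd[OF uv(2)] ord by (simp add: dist_commute)
    then show ?thesis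
      using far_uv t(3) dist_triangle[of t "z i" "\<pi> (Suc i mod 3)"] by linarith
  qed
  have "D < dist (\<pi> j) (\<pi> (Suc j mod 3))" if j: "j < 3" for j
  proof -
    let ?k = "Suc j mod 3"
    have zij: "dist (z i) (z j) \<le> 2 * r"
      using z(2)[OF i] z(2)[OF j] dist_triangle2[of "z i" "z j" a] by linarith
    then have zjQ: "z j \<in> nbhd (\<kappa> + 2 * r) Q" using nbhd_step[OF zQ] by simp
    have "0 \<le> \<kappa> + 2 * r" using \<kappa> r by simp
    then have det: "dist (V l) (\<pi> l) + dist (\<pi> l) (z j) \<le> dist (V l) (z j) + 2 * R" for l
      using projection_detour[OF _ Q \<pi> zjQ] unfolding R_def \<kappa>_def by blast
    have "dist (\<pi> j) (z j) + dist (\<pi> ?k) (z j) \<le> dist (\<pi> j) (\<pi> ?k) + 4 * R"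
      using det[of j] det[of ?k] segment_dist_add[OF S[OF j] z(1)[OF j]]
        dist_triangle[of "V j" "V ?k" "\<pi> j"] dist_triangle[of "\<pi> j" "V ?k" "\<pi> ?k"]
      by (simp add: dist_commute)
    moreover have "j = i \<or> ?k = i \<or> j = Suc i mod 3 \<or> ?k = Suc i mod 3"
      using three[OF i] three[OF j] by auto
    then have "E < dist (\<pi> j) (z i) \<or> E < dist (\<pi> ?k) (z i)" using end1 end2 by auto
    moreover have "dist (\<pi> l) (z i) \<le> dist (\<pi> l) (z j) + 2 * r" for l
      using zij dist_triangle[of "\<pi> l" "z i" "z j"] by (simp add: dist_commute)
    from this[of j] this[of ?k]
    have "dist (\<pi> j) (z i) \<le> dist (\<pi> j) (z j) + 2 * r"
      "dist (\<pi> ?k) (z i) \<le> dist (\<pi> ?k) (z j) + 2 * r" .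
    ultimately show ?thesis
      using sh zero_le_dist[of "\<pi> j" "z j"] zero_le_dist[of "\<pi> ?k" "z j"] unfolding E_def by linarith
  qed
  then show ?thesis using Q \<pi> unfolding spread_def by blast
qed

text \<open>
  Exit points are entrance points of the reversed sides. So the exit point of a side and the entrance
  point of the next one are both near the projection of their common vertex.
\<close>
lemma spread_imp_cond_P:
  assumes C: "0 \<le> C" and Q: "Q \<in> \<P>"
    and \<alpha>: "\<And>i. i < 3 \<Longrightarrow> almost_straight C (\<alpha> i) (L i)" and tri: "triangle \<alpha> L"
    and spread: "spread (far C) Q (\<lambda>i. \<alpha> i 0)"
    and \<sigma>: "follow C M \<le> \<sigma>" "follow C (shadow approach) \<le> \<sigma>"
  shows "cond_P \<P> \<sigma> (2 * entry C \<sigma>) \<alpha> L"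
proof -
  obtain \<pi> where \<pi>: "\<And>i. i < 3 \<Longrightarrow> coarse_projection Q (\<alpha> i 0) (\<pi> i)"
    and far: "\<And>i. i < 3 \<Longrightarrow> far C < dist (\<pi> i) (\<pi> (Suc i mod 3))"
    using spread unfolding spread_def by auto
  have \<pi>': "coarse_projection Q (\<alpha> i (L i)) (\<pi> (Suc i mod 3))" if "i < 3" for i
    using \<pi>[of "Suc i mod 3"] tri that unfolding triangle_def by simp
  have meet: "\<exists>t\<in>{0..L i}. \<alpha> i t \<in> nbhd \<sigma> Q" if i: "i < 3" for i
    by (rule far_projections_meet[OF C Q \<alpha>[OF i] \<pi>[OF i] \<pi>'[OF i] far[OF i] \<sigma>(2)])
  have "\<exists>x y. is_entrance_point (\<alpha> i) (L i) (nbhd \<sigma> Q) x \<and> is_exit_point (\<alpha> i) (L i) (nbhd \<sigma> Q) y \<and>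
    dist x (\<pi> i) \<le> entry C \<sigma> \<and> dist y (\<pi> (Suc i mod 3)) \<le> entry C \<sigma>" if i: "i < 3" for i
  proof -
    obtain t where t: "t \<in> {0..L i}" "\<alpha> i t \<in> nbhd \<sigma> Q" using meet[OF i] by blast
    let ?\<beta> = "\<lambda>t. \<alpha> i (L i - t)"
    have \<beta>: "almost_straight C ?\<beta> (L i)" by (rule almost_straight_rev[OF \<alpha>[OF i]])
    obtain x where x: "is_entrance_point (\<alpha> i) (L i) (nbhd \<sigma> Q) x"
      using entrance_point_ex[OF \<alpha>[OF i] t] by blast
    obtain y where y: "is_entrance_point ?\<beta> (L i) (nbhd \<sigma> Q) y"
      using entrance_point_ex[OF \<beta>, of "L i - t"] t by auto
    have "dist x (\<pi> i) \<le> entry C \<sigma>"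
      by (rule entrance_near_projection[OF C Q \<alpha>[OF i] \<pi>[OF i] \<sigma>(1) x])
    moreover have "dist y (\<pi> (Suc i mod 3)) \<le> entry C \<sigma>"
      by (rule entrance_near_projection[OF C Q \<beta> _ \<sigma>(1) y]) (use \<pi>'[OF i] in simp)
    ultimately show ?thesis using x exit_point_rev[OF y] by blast
  qed
  then obtain x y where xy: "\<And>i. i < 3 \<Longrightarrow> is_entrance_point (\<alpha> i) (L i) (nbhd \<sigma> Q) (x i)"
    "\<And>i. i < 3 \<Longrightarrow> is_exit_point (\<alpha> i) (L i) (nbhd \<sigma> Q) (y i)"
    "\<And>i. i < 3 \<Longrightarrow> dist (x i) (\<pi> i) \<le> entry C \<sigma>"
    "\<And>i. i < 3 \<Longrightarrow> dist (y i) (\<pi> (Suc i mod 3)) \<le> entry C \<sigma>"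
    by metis
  have "dist (y i) (x (Suc i mod 3)) \<le> 2 * entry C \<sigma>" if i: "i < 3" for i
    using xy(4)[OF i] xy(3)[of "Suc i mod 3"]
      dist_triangle2[of "y i" "x (Suc i mod 3)" "\<pi> (Suc i mod 3)"] by simp
  moreover have "\<alpha> i ` {0..L i} \<inter> nbhd \<sigma> Q \<noteq> {}" if "i < 3" for i using meet[OF that] by blast
  ultimately show ?thesis unfolding cond_P_def using Q xy(1,2) by blast
qed

text \<open>
  The radius \<open>\<sigma>\<close> has to serve both cases at once. This is possible because \<open>spread_imp_cond_P\<close> holds
  for all sufficiently large radii.
\<close>
theorem star_asymp_tree_graded: "star_asymp_tree_graded \<P>"
  unfolding star_asymp_tree_graded_def triangle_condition_def
proof (intro allI impI)
  fix c :: real assume c: "0 \<le> c"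
  define C where "C = 3 * c"
  define r where "r = \<delta> + shadow \<delta> + far C"
  define \<sigma> where "\<sigma> = follow C M + follow C (shadow approach) + r + wander C r (far C)"
  have C: "0 \<le> C" using c by (simp add: C_def)
  have gap: "0 \<le> gap"
    using shadow_nonneg[of 0] delta_nonneg qhull_ge(3)[of "shadow 0"]
      B_nonneg[of "qhull (shadow 0) + qhull \<delta>"] unfolding gap_def by linarith
  have far: "0 \<le> far C"
    using gap shadow_nonneg[of approach] follow_pos[OF C, of "shadow approach"]
    unfolding far_def by linarith
  have r: "0 \<le> r" using far shadow_nonneg[of \<delta>] delta_nonneg by (simp add: r_def)
  have "0 \<le> drift C" using qhull_ge(3)[of \<delta>] delta_nonneg C by (simp add: drift_def)
  then have "0 \<le> wander C r (far C)"
    using shadow_nonneg[of "drift C"] shadow_nonneg[of "drift C + 2 * r"] r far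
    by (simp add: wander_def)
  then have \<sigma>: "follow C M \<le> \<sigma>" "follow C (shadow approach) \<le> \<sigma>" "r + wander C r (far C) \<le> \<sigma>"
    using follow_pos[OF C, of M] follow_pos[OF C, of "shadow approach"] r unfolding \<sigma>_def by auto
  have "cond_C \<sigma> \<alpha> L \<or> cond_P \<P> \<sigma> (2 * entry C \<sigma>) \<alpha> L"
    if "triangle \<alpha> L \<and> (\<forall>i<3. almost_geodesic 1 c (\<alpha> i) (L i))" for \<alpha> L
  proof (cases "\<exists>Q\<in>\<P>. spread (far C) Q (\<lambda>i. \<alpha> i 0)")
    case True
    then show ?thesis
      using that spread_imp_cond_P[OF C _ _ _ _ \<sigma>(1,2)] almost_geodesic_almost_straight
      unfolding C_def by blast
  next
    case False
    define V where "V i = \<alpha> i 0" for i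
    have \<alpha>: "almost_straight C (\<alpha> i) (L i)" if "i < 3" for i
      using almost_geodesic_almost_straight that \<open>triangle \<alpha> L \<and> _\<close> unfolding C_def by blast
    have L: "0 \<le> L i" "\<alpha> i (L i) = V (Suc i mod 3)" if "i < 3" for i
      using that \<open>triangle \<alpha> L \<and> _\<close> by (auto simp: triangle_def V_def)
    have "\<forall>i. \<exists>S. geodesic_segment S (V i) (V (Suc i mod 3))" using segment_ex by blast
    then obtain S where S: "\<And>i. geodesic_segment (S i) (V i) (V (Suc i mod 3))" by metis
    obtain a z where z: "\<And>i. i < 3 \<Longrightarrow> z i \<in> S i" "\<And>i. i < 3 \<Longrightarrow> dist (z i) a \<le> r"
      using common_point[of S V, OF S far] False unfolding r_def V_def by blast
    have "\<alpha> i ` {0..L i} \<inter> cball a \<sigma> \<noteq> {}" if i: "i < 3" for i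
    proof -
      have "dist (V i) (z i) \<le> dist (\<alpha> i 0) (\<alpha> i (L i))"
        using segment_dist_add[OF S z(1)[OF i]] zero_le_dist[of "z i" "V (Suc i mod 3)"]
        unfolding L(2)[OF i] V_def[of i, symmetric] by linarith
      then obtain t where t: "t \<in> {0..L i}" "dist (V i) (\<alpha> i t) = dist (V i) (z i)"
        "dist (V i) (\<alpha> i t) + dist (\<alpha> i t) (V (Suc i mod 3)) \<le> dist (V i) (V (Suc i mod 3)) + C"
        using almost_straight_point[OF \<alpha>[OF i] order_refl L(1)[OF i] order_refl zero_le_dist, of "V i" "z i"] L(2)[OF i]
        unfolding V_def[of i] by auto
      have "dist (\<alpha> i t) (z i) \<le> wander C r (far C)"
        using wander_spread[OF C far r S z i t(2,3)] False
        unfolding V_def by (meson not_less)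
      then have "dist a (\<alpha> i t) \<le> \<sigma>"
        using z(2)[OF i] \<sigma>(3) dist_triangle[of a "\<alpha> i t" "z i"] by (simp add: dist_commute)
      then have "\<alpha> i t \<in> \<alpha> i ` {0..L i} \<inter> cball a \<sigma>" using t(1) by simp
      then show ?thesis by blast
    qed
    then show ?thesis unfolding cond_C_def by blast
  qed
  then show "\<exists>\<sigma> \<delta>. \<forall>\<alpha> L. triangle \<alpha> L \<and> (\<forall>i<3. almost_geodesic 1 c (\<alpha> i) (L i)) \<longrightarrow>
      cond_C \<sigma> \<alpha> L \<or> cond_P \<P> \<sigma> \<delta> \<alpha> L"
    by blast
qed

end

section \<open>The equivalence\<close>

lemma geodesic_imp_almost_geodesic:
  assumes "geodesic \<gamma> L" "0 \<le> C"
  shows "almost_geodesic 1 C \<gamma> L"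
proof -
  have "1-lipschitz_on {0..L} \<gamma>"
    using assms(1) by (intro lipschitz_onI) (auto simp: geodesic_def dist_real_def)
  then show ?thesis
    using assms lipschitz_on_continuous_on
    by (auto simp: almost_geodesic_def quasi_geodesic_def geodesic_def)
qed

lemma weakly_star_asymp_tree_graded_thin:
  assumes "weakly_star_asymp_tree_graded \<P>"
  shows "\<exists>\<delta>\<ge>0. \<forall>x y z S\<^sub>0 S\<^sub>1 S\<^sub>2.
    geodesic_segment S\<^sub>0 x y \<longrightarrow> geodesic_segment S\<^sub>1 y z \<longrightarrow> geodesic_segment S\<^sub>2 z x \<longrightarrow>
      (\<exists>e\<^sub>0\<in>S\<^sub>0. \<exists>f\<^sub>0\<in>S\<^sub>0. \<exists>e\<^sub>1\<in>S\<^sub>1. \<exists>f\<^sub>1\<in>S\<^sub>1. \<exists>e\<^sub>2\<in>S\<^sub>2. \<exists>f\<^sub>2\<in>S\<^sub>2.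
        dist f\<^sub>0 e\<^sub>1 \<le> \<delta> \<and> dist f\<^sub>1 e\<^sub>2 \<le> \<delta> \<and> dist f\<^sub>2 e\<^sub>0 \<le> \<delta> \<and>
        (e\<^sub>0 = f\<^sub>0 \<and> e\<^sub>1 = f\<^sub>1 \<and> e\<^sub>2 = f\<^sub>2 \<or> (\<exists>Q\<in>\<P>. {e\<^sub>0, f\<^sub>0, e\<^sub>1, f\<^sub>1, e\<^sub>2, f\<^sub>2} \<subseteq> nbhd \<delta> Q)))"
proof -
  obtain \<sigma> \<delta> where CP: "\<And>\<gamma> L. triangle \<gamma> L \<Longrightarrow> (\<And>i. i < 3 \<Longrightarrow> geodesic (\<gamma> i) (L i)) \<Longrightarrow>
      cond_C \<sigma> \<gamma> L \<or> cond_P \<P> \<sigma> \<delta> \<gamma> L"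
    using assms unfolding weakly_star_asymp_tree_graded_def triangle_condition_def by (meson order_refl)
  define d where "d = max 0 (max (2 * \<sigma>) (max \<sigma> \<delta>))"
  have d: "0 \<le> d" "2 * \<sigma> \<le> d" "\<sigma> \<le> d" "\<delta> \<le> d" by (auto simp: d_def)
  show ?thesis
  proof (rule exI[of _ d], intro conjI allI impI d(1))
    fix x y z :: 'a and S\<^sub>0 S\<^sub>1 S\<^sub>2
    assume S: "geodesic_segment S\<^sub>0 x y" "geodesic_segment S\<^sub>1 y z" "geodesic_segment S\<^sub>2 z x"
    obtain \<gamma>\<^sub>0 L\<^sub>0 where g0: "geodesic \<gamma>\<^sub>0 L\<^sub>0" "\<gamma>\<^sub>0 0 = x" "\<gamma>\<^sub>0 L\<^sub>0 = y" "S\<^sub>0 = \<gamma>\<^sub>0 ` {0..L\<^sub>0}"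
      using S(1) unfolding geodesic_segment_def by blast
    obtain \<gamma>\<^sub>1 L\<^sub>1 where g1: "geodesic \<gamma>\<^sub>1 L\<^sub>1" "\<gamma>\<^sub>1 0 = y" "\<gamma>\<^sub>1 L\<^sub>1 = z" "S\<^sub>1 = \<gamma>\<^sub>1 ` {0..L\<^sub>1}"
      using S(2) unfolding geodesic_segment_def by blast
    obtain \<gamma>\<^sub>2 L\<^sub>2 where g2: "geodesic \<gamma>\<^sub>2 L\<^sub>2" "\<gamma>\<^sub>2 0 = z" "\<gamma>\<^sub>2 L\<^sub>2 = x" "S\<^sub>2 = \<gamma>\<^sub>2 ` {0..L\<^sub>2}"
      using S(3) unfolding geodesic_segment_def by blast
    define \<gamma> where "\<gamma> = (\<lambda>i::nat. if i = 0 then \<gamma>\<^sub>0 else if i = 1 then \<gamma>\<^sub>1 else \<gamma>\<^sub>2)"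
    define L where "L = (\<lambda>i::nat. if i = 0 then L\<^sub>0 else if i = 1 then L\<^sub>1 else L\<^sub>2)"
    have three: "(\<forall>i<3. A i) \<longleftrightarrow> A 0 \<and> A 1 \<and> A 2" for A :: "nat \<Rightarrow> bool"
      by (auto simp: numeral_3_eq_3 numeral_2_eq_2 less_Suc_eq)
    have next3: "Suc 0 mod 3 = 1" "Suc 1 mod 3 = 2" "Suc 2 mod 3 = 0" by simp_all
    have vals: "\<gamma> 0 = \<gamma>\<^sub>0" "\<gamma> 1 = \<gamma>\<^sub>1" "\<gamma> 2 = \<gamma>\<^sub>2" "L 0 = L\<^sub>0" "L 1 = L\<^sub>1" "L 2 = L\<^sub>2"
      by (auto simp: \<gamma>_def L_def)
    have "0 \<le> L\<^sub>0" "0 \<le> L\<^sub>1" "0 \<le> L\<^sub>2" using g0 g1 g2 by (auto simp: geodesic_def)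
    then have "triangle \<gamma> L"
      unfolding triangle_def three next3 vals using g0 g1 g2 by simp
    moreover have "geodesic (\<gamma> i) (L i)" if "i < 3" for i
      using g0 g1 g2 by (auto simp: \<gamma>_def L_def)
    ultimately consider "cond_C \<sigma> \<gamma> L" | "cond_P \<P> \<sigma> \<delta> \<gamma> L" using CP by blast
    then show "\<exists>e\<^sub>0\<in>S\<^sub>0. \<exists>f\<^sub>0\<in>S\<^sub>0. \<exists>e\<^sub>1\<in>S\<^sub>1. \<exists>f\<^sub>1\<in>S\<^sub>1. \<exists>e\<^sub>2\<in>S\<^sub>2. \<exists>f\<^sub>2\<in>S\<^sub>2.
        dist f\<^sub>0 e\<^sub>1 \<le> d \<and> dist f\<^sub>1 e\<^sub>2 \<le> d \<and> dist f\<^sub>2 e\<^sub>0 \<le> d \<and>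
        (e\<^sub>0 = f\<^sub>0 \<and> e\<^sub>1 = f\<^sub>1 \<and> e\<^sub>2 = f\<^sub>2 \<or> (\<exists>Q\<in>\<P>. {e\<^sub>0, f\<^sub>0, e\<^sub>1, f\<^sub>1, e\<^sub>2, f\<^sub>2} \<subseteq> nbhd d Q))"
    proof cases
      case 1
      then obtain a where "S\<^sub>0 \<inter> cball a \<sigma> \<noteq> {}" "S\<^sub>1 \<inter> cball a \<sigma> \<noteq> {}" "S\<^sub>2 \<inter> cball a \<sigma> \<noteq> {}"
        unfolding cond_C_def three vals g0(4) g1(4) g2(4) by blast
      then obtain u v w where uvw: "u \<in> S\<^sub>0" "v \<in> S\<^sub>1" "w \<in> S\<^sub>2" "dist a u \<le> \<sigma>" "dist a v \<le> \<sigma>" "dist a w \<le> \<sigma>"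
        by auto
      then have "dist u v \<le> d" "dist v w \<le> d" "dist w u \<le> d"
        using d(2) dist_triangle3[of u v a] dist_triangle3[of v w a] dist_triangle3[of w u a] by linarith+
      with uvw show ?thesis by blast
    next
      case 2
      then obtain Q and e f :: "nat \<Rightarrow> 'a" where Q: "Q \<in> \<P>"
        and ent: "is_entrance_point \<gamma>\<^sub>0 L\<^sub>0 (nbhd \<sigma> Q) (e 0)" "is_entrance_point \<gamma>\<^sub>1 L\<^sub>1 (nbhd \<sigma> Q) (e 1)"
          "is_entrance_point \<gamma>\<^sub>2 L\<^sub>2 (nbhd \<sigma> Q) (e 2)"
        and ex: "is_exit_point \<gamma>\<^sub>0 L\<^sub>0 (nbhd \<sigma> Q) (f 0)" "is_exit_point \<gamma>\<^sub>1 L\<^sub>1 (nbhd \<sigma> Q) (f 1)"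
          "is_exit_point \<gamma>\<^sub>2 L\<^sub>2 (nbhd \<sigma> Q) (f 2)"
        and ef: "dist (f 0) (e 1) \<le> \<delta>" "dist (f 1) (e 2) \<le> \<delta>" "dist (f 2) (e 0) \<le> \<delta>"
        unfolding cond_P_def three vals next3 by blast
      note E = ent[THEN entrance_point_mem] and F = ex[THEN exit_point_mem]
      have mem: "e 0 \<in> S\<^sub>0" "e 1 \<in> S\<^sub>1" "e 2 \<in> S\<^sub>2" "f 0 \<in> S\<^sub>0" "f 1 \<in> S\<^sub>1" "f 2 \<in> S\<^sub>2"
        unfolding g0(4) g1(4) g2(4) using E F by auto
      have "e 0 \<in> nbhd \<sigma> Q" "e 1 \<in> nbhd \<sigma> Q" "e 2 \<in> nbhd \<sigma> Q"
        "f 0 \<in> nbhd \<sigma> Q" "f 1 \<in> nbhd \<sigma> Q" "f 2 \<in> nbhd \<sigma> Q"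
        using E F by auto
      then have "{e 0, f 0, e 1, f 1, e 2, f 2} \<subseteq> nbhd d Q"
        using nbhd_mono[OF _ d(3)] by blast
      moreover have "dist (f 0) (e 1) \<le> d" "dist (f 1) (e 2) \<le> d" "dist (f 2) (e 0) \<le> d"
        using ef d(4) by linarith+
      ultimately show ?thesis using mem Q by blast
    qed
  qed
qed

theorem proposition5p1:
  fixes \<P> :: "'a::metric_space set set"
  assumes "geodesic_space TYPE('a)"
  shows "hyperbolic_relative_to \<P> \<longleftrightarrow>
           alpha1 \<P> \<and> alpha2 \<P> \<and> weakly_star_asymp_tree_graded \<P>"
proof
  assume "hyperbolic_relative_to \<P>"
  then show "alpha1 \<P> \<and> alpha2 \<P> \<and> weakly_star_asymp_tree_graded \<P>"
    unfolding hyperbolic_relative_to_def star_asymp_tree_graded_def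
      weakly_star_asymp_tree_graded_def triangle_condition_def
    using geodesic_imp_almost_geodesic by meson
next
  assume hyp: "alpha1 \<P> \<and> alpha2 \<P> \<and> weakly_star_asymp_tree_graded \<P>"
  then obtain B where B: "\<And>K P Q. P \<in> \<P> \<Longrightarrow> Q \<in> \<P> \<Longrightarrow> P \<noteq> Q \<Longrightarrow>
      bounded (nbhd K P \<inter> nbhd K Q) \<and> diameter (nbhd K P \<inter> nbhd K Q) \<le> B K"
    unfolding alpha1_def by metis
  obtain \<epsilon> M where eM: "0 < \<epsilon>" "0 \<le> M"
    and pen: "\<And>P x y \<gamma> L. P \<in> \<P> \<Longrightarrow> x \<in> nbhd (\<epsilon> * dist x y) P \<Longrightarrow> y \<in> nbhd (\<epsilon> * dist x y) P \<Longrightarrow>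
      geodesic \<gamma> L \<Longrightarrow> \<gamma> 0 = x \<Longrightarrow> \<gamma> L = y \<Longrightarrow> \<gamma> ` {0..L} \<inter> nbhd M P \<noteq> {}"
    using hyp unfolding alpha2_def by blast
  obtain \<delta> where \<delta>: "0 \<le> \<delta>" and thin: "\<And>x y z S\<^sub>0 S\<^sub>1 S\<^sub>2.
    geodesic_segment S\<^sub>0 x y \<Longrightarrow> geodesic_segment S\<^sub>1 y z \<Longrightarrow> geodesic_segment S\<^sub>2 z x \<Longrightarrow>
      (\<exists>e\<^sub>0\<in>S\<^sub>0. \<exists>f\<^sub>0\<in>S\<^sub>0. \<exists>e\<^sub>1\<in>S\<^sub>1. \<exists>f\<^sub>1\<in>S\<^sub>1. \<exists>e\<^sub>2\<in>S\<^sub>2. \<exists>f\<^sub>2\<in>S\<^sub>2.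
        dist f\<^sub>0 e\<^sub>1 \<le> \<delta> \<and> dist f\<^sub>1 e\<^sub>2 \<le> \<delta> \<and> dist f\<^sub>2 e\<^sub>0 \<le> \<delta> \<and>
        (e\<^sub>0 = f\<^sub>0 \<and> e\<^sub>1 = f\<^sub>1 \<and> e\<^sub>2 = f\<^sub>2 \<or> (\<exists>Q\<in>\<P>. {e\<^sub>0, f\<^sub>0, e\<^sub>1, f\<^sub>1, e\<^sub>2, f\<^sub>2} \<subseteq> nbhd \<delta> Q)))"
    using weakly_star_asymp_tree_graded_thin[of \<P>] hyp by auto
  interpret peripheral_family \<P> "\<lambda>K. max 0 (B K)" \<epsilon> M \<delta>
  proof (unfold_locales, goal_cases)
    case (1 x y)
    then show ?case using assms unfolding geodesic_space_def geodesic_segment_def by metis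
  next
    case (3 P Q x K y)
    then have "dist x y \<le> diameter (nbhd K P \<inter> nbhd K Q)"
      using B[OF 3(1-3), of K] by (intro diameter_bounded_bound) auto
    then show ?case using B[OF 3(1-3), of K] by linarith
  next
    case (6 P S x y)
    then show ?case using pen unfolding geodesic_segment_def by blast
  next
    case 8 then show ?case by (rule thin)
  qed (use eM \<delta> in auto)
  show "hyperbolic_relative_to \<P>"
    using hyp star_asymp_tree_graded unfolding hyperbolic_relative_to_def by blast
qed

end
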